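(* Let $0<\delta<1$ and let $Q$ be a positive random variable with $E(Q)=1$ but with otherwise arbitrary distribution. Consider the homogeneous continuous-time branching process with birth rate $\delta$ and life-length distribution $Q$, let $X(u)$ denote the number of individuals alive at time $u\ge 0$, and assume $X(0)=1$. Let $A_K=\int_0^\infty 1_{\{X(u)=K\}}\,du$ for $K\ge 1$, and let $T=\sum_{K=1}^\infty A_K=\int_0^\infty 1_{\{X(u)\ge 1\}}\,du$ be the total time until extinction. Then $$E(T)=\sum_{K=1}^\infty E(A_K)=\frac{-\log(1-\delta)}{\delta}.$$
   Context: The branching process (a binary splitting tree) is defined as follows. At time $0$ there is one newborn ancestor. Every individual lives for a random time distributed as $Q$; during its life it gives birth to single children at the points of a Poisson process of constant rate $\delta$. All life-lengths and all birth Poisson processes are mutually independent, and each child from its birth behaves in the same way. *)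

theory Defs
  imports "HOL-Probability.Probability" "HOL-Library.Extended_Nat"
begin

text \<open>
  The sequence \<open>S 0, S 1, \<dots>\<close> lists the points of a homogeneous Poisson process on the
  positive half-line in increasing order: the waiting times \<open>S 0, S 1 - S 0, S 2 - S 1, \<dots>\<close> are
  independent and exponentially distributed with parameter \<open>r\<close> (mean \<open>1 / r\<close>).
\<close>
definition poisson_points :: "'w measure \<Rightarrow> real \<Rightarrow> (nat \<Rightarrow> 'w \<Rightarrow> real) \<Rightarrow> bool" where
  "poisson_points M r S \<longleftrightarrow>
     (let W = (\<lambda>n \<omega>. if n = 0 then S 0 \<omega> else S n \<omega> - S (n - 1) \<omega>) in
        prob_space.indep_vars M (\<lambda>_. borel) W UNIV \<and>
        (\<forall>n. distributed M lborel (W n) (exponential_density r)))"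

text \<open>
  Individuals carry Ulam--Harris labels, written with the most recent generation first: \<open>[]\<close> is
  the ancestor and \<open>n # x\<close> is the \<open>n\<close>-th child (counting from \<open>0\<close>) of \<open>x\<close>.
  The random variable \<open>L x\<close> is the life-length of \<open>x\<close>, and \<open>S x n\<close> is the \<open>n\<close>-th point of the birth
  process of \<open>x\<close>, on the time scale given by the age of \<open>x\<close>.  These are given for all labels; points
  \<open>S x n\<close> beyond the life-length of \<open>x\<close> are ignored later, in \<open>born\<close>.

  In \<open>indep\<close>, the index \<open>Inl x\<close> stands for the sigma-algebra generated by the life-length of \<open>x\<close>
  and \<open>Inr x\<close> for the one generated by the whole birth process of \<open>x\<close>.
\<close>
locale binary_splitting_tree = prob_space M
  for M :: "'w measure" +
  fixes \<delta> :: real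
    and life_law :: "real measure"
    and L :: "nat list \<Rightarrow> 'w \<Rightarrow> real"
    and S :: "nat list \<Rightarrow> nat \<Rightarrow> 'w \<Rightarrow> real"
  assumes life_measurable: "\<And>x. random_variable borel (L x)"
    and life_distr: "\<And>x. distr M borel (L x) = life_law"
    and births_poisson: "\<And>x. poisson_points M \<delta> (S x)"
    and indep: "indep_sets
        (case_sum
          (\<lambda>x. sets (vimage_algebra (space M) (L x) borel))
          (\<lambda>x. sets (vimage_algebra (space M) (\<lambda>\<omega> n. S x n \<omega>) (\<Pi>\<^sub>M n\<in>UNIV. borel))))
        UNIV"

primrec birth_time :: "(nat list \<Rightarrow> nat \<Rightarrow> 'w \<Rightarrow> real) \<Rightarrow> nat list \<Rightarrow> 'w \<Rightarrow> real" where
  "birth_time S [] \<omega> = 0"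
| "birth_time S (n # x) \<omega> = birth_time S x \<omega> + S x n \<omega>"

primrec born :: "(nat list \<Rightarrow> 'w \<Rightarrow> real) \<Rightarrow> (nat list \<Rightarrow> nat \<Rightarrow> 'w \<Rightarrow> real) \<Rightarrow> nat list \<Rightarrow> 'w \<Rightarrow> bool" where
  "born L S [] \<omega> = True"
| "born L S (n # x) \<omega> = (born L S x \<omega> \<and> S x n \<omega> < L x \<omega>)"

definition alive ::
  "(nat list \<Rightarrow> 'w \<Rightarrow> real) \<Rightarrow> (nat list \<Rightarrow> nat \<Rightarrow> 'w \<Rightarrow> real) \<Rightarrow> real \<Rightarrow> 'w \<Rightarrow> nat list set" where
  "alive L S u \<omega> =
     {x. born L S x \<omega> \<and> birth_time S x \<omega> \<le> u \<and> u < birth_time S x \<omega> + L x \<omega>}"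

text \<open>
  The value is an extended natural number, so that an infinite population (an event of probability
  zero that the construction does not exclude pointwise) is not counted as extinct.  The starting
  condition that there is one individual at time \<open>0\<close> is built in: the ancestor is born at time \<open>0\<close>,
  and almost surely its life-length and all points of the birth processes are positive.
\<close>
definition population ::
  "(nat list \<Rightarrow> 'w \<Rightarrow> real) \<Rightarrow> (nat list \<Rightarrow> nat \<Rightarrow> 'w \<Rightarrow> real) \<Rightarrow> real \<Rightarrow> 'w \<Rightarrow> enat" where
  "population L S u \<omega> =
     (if finite (alive L S u \<omega>) then enat (card (alive L S u \<omega>)) else \<infinity>)"

definition time_at ::
  "(nat list \<Rightarrow> 'w \<Rightarrow> real) \<Rightarrow> (nat list \<Rightarrow> nat \<Rightarrow> 'w \<Rightarrow> real) \<Rightarrow> nat \<Rightarrow> 'w \<Rightarrow> ennreal" where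
  "time_at L S K \<omega> =
     (\<integral>\<^sup>+u\<in>{0..}. indicator {u. population L S u \<omega> = enat K} u \<partial>lborel)"

definition total_time ::
  "(nat list \<Rightarrow> 'w \<Rightarrow> real) \<Rightarrow> (nat list \<Rightarrow> nat \<Rightarrow> 'w \<Rightarrow> real) \<Rightarrow> 'w \<Rightarrow> ennreal" where
  "total_time L S \<omega> =
     (\<integral>\<^sup>+u\<in>{0..}. indicator {u. population L S u \<omega> \<ge> 1} u \<partial>lborel)"

end

(*
  Let q(u) be the probability that the population is extinct at time u, let p = 1 - q and
  G(t) = exp (\<delta> * integral of p over [0, t]).  Conditioning on the life-length and the births of the
  ancestor, and using the probability generating functional of the Poisson process, gives
  q(u) = E [1_{Q <= u} G(u - Q) / G(u)].  Since G' = \<delta> p G = \<delta> (G - q G), this is the linear renewal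
  equation G(t) = 1 + \<delta> E [integral of G over [t - Q, t]] (with G = 0 before 0).  As G is increasing
  and E(Q) = 1, it follows that G is bounded with limit g satisfying g = 1 + \<delta> g, so that
  E(T) = integral of p over [0, \<infinity>) = ln (1 / (1 - \<delta>)) / \<delta>.

  The generating functional is obtained from a martingale: if \<Psi>(s) is the expected product of the
  weights of the points after s, then the product of the weights of the first n points times
  \<Psi>(n-th point) has constant expectation, because \<Psi> is a fixed point of the one-step operator.
*)
theory Submission
  imports Defs
begin

section \<open>Exponentials of indefinite integrals\<close>

text \<open>The substitution behind \<open>growth\<close> linearises the problem: the Poisson
  functional makes q(u) an expectation of exp (- \<delta> * integral of p over [u - Q, u]), and this
  exponential is the quotient G(u - Q) / G(u), so multiplying by G(u) leaves an equation linear in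
  G. Three obstacles shape the rest. The survival function is known only to be measurable and
  bounded, so G' = \<delta> p G is used in integrated form. The ancestor carries infinitely many
  child labels, so extinction of all subtrees is approached through the first n of them, with bounds
  on both sides that close up as n grows. Finally, an infinite population would count towards T but
  towards no A_K; the identity between T and the sum of the A_K rests on the total progeny being
  almost surely finite, which follows from its mean, the geometric series in \<delta>. The
  computation is done under the product law of the labelled tree and carried over to the given
  sample space at the end.\<close>

lemma bounded_borel_integrable_on:
  fixes k :: "real \<Rightarrow> real"
  assumes "k \<in> borel_measurable borel" "\<And>v. \<bar>k v\<bar> \<le> C"
  shows "k integrable_on {a..b}"
proof (rule measurable_bounded_by_integrable_imp_integrable)
  show "k \<in> borel_measurable (lebesgue_on {a..b})"
    using assms(1) by (intro measurable_restrict_space1 measurable_completion) simp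
  show "(\<lambda>_. C) integrable_on {a..b}" by auto
qed (use assms in auto)

lemma abs_exp_diff_le:
  fixes a b :: real
  assumes "\<bar>a\<bar> \<le> R" "\<bar>b\<bar> \<le> R"
  shows "\<bar>exp b - exp a\<bar> \<le> exp R * \<bar>b - a\<bar>"
proof -
  have *: "exp y - exp x \<le> exp R * (y - x)" if "x \<le> y" "\<bar>y\<bar> \<le> R" for x y :: real
  proof -
    have "1 + (x - y) \<le> exp (x - y)" by simp
    then have "exp y * (1 + (x - y)) \<le> exp y * exp (x - y)" by (intro mult_left_mono) auto
    then have "exp y - exp x \<le> exp y * (y - x)" by (simp add: exp_diff algebra_simps)
    also have "\<dots> \<le> exp R * (y - x)" using that by (intro mult_right_mono) auto
    finally show ?thesis .
  qed
  show ?thesis using *[of a b] *[of b a] assms by (cases "a \<le> b") (auto simp: abs_if algebra_simps)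
qed

text \<open>Convexity alone: the tangent at \<open>a\<close> makes the error nonnegative, and the
  tangent at \<open>b\<close> bounds it by \<open>(exp b - exp a) * (b - a)\<close>. With a
  Lipschitz bound for the exponential this is quadratic in \<open>b - a\<close>.\<close>

lemma abs_exp_taylor1_le:
  fixes a b :: real
  shows "\<bar>exp b - exp a - exp a * (b - a)\<bar> \<le> \<bar>b - a\<bar> * \<bar>exp b - exp a\<bar>"
proof -
  have l: "exp x * (y - x) \<le> exp y - exp x" for x y :: real
  proof -
    have "1 + (y - x) \<le> exp (y - x)" by simp
    then have "exp x * (1 + (y - x)) \<le> exp x * exp (y - x)" by (intro mult_left_mono) auto
    then show ?thesis by (simp add: exp_diff algebra_simps)
  qed
  have "exp b - exp a - exp a * (b - a) \<le> (exp b - exp a) * (b - a)"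
    using l[of b a] by (simp add: algebra_simps)
  also have "\<dots> \<le> \<bar>b - a\<bar> * \<bar>exp b - exp a\<bar>"
    by (metis abs_ge_self abs_mult mult.commute)
  finally show ?thesis using l[of a b] by simp
qed

text \<open>
  The integrand is only measurable, so the fundamental theorem of calculus is replaced by the
  observation that the difference of the two sides varies by \<open>O(h\<^sup>2)\<close> over intervals of length \<open>h\<close>.
\<close>
lemma has_integral_exp_integral:
  fixes k :: "real \<Rightarrow> real"
  assumes k: "k \<in> borel_measurable borel" and C: "\<And>v. \<bar>k v\<bar> \<le> C" and t: "0 \<le> t"
  shows "((\<lambda>v. k v * exp (integral {0..v} k)) has_integral exp (integral {0..t} k) - 1) {0..t}"
proof -
  define K where "K v = integral {0..v} k" for v
  define D where "D v = exp (K v) - integral {0..v} (\<lambda>w. k w * exp (K w))" for v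
  define B where "B = exp (C * t)"
  have C0: "0 \<le> C" using C[of 0] by auto
  have ki: "k integrable_on {a..b}" for a b
    using k C by (rule bounded_borel_integrable_on)
  have Kdiff: "integral {x..y} k = K y - K x" if "0 \<le> x" "x \<le> y" for x y
    using Henstock_Kurzweil_Integration.integral_combine[OF that ki] by (simp add: K_def)
  have Klip: "\<bar>K y - K x\<bar> \<le> C * (y - x)" if "0 \<le> x" "x \<le> y" for x y
  proof -
    have "norm (integral {x..y} k) \<le> integral {x..y} (\<lambda>_. C)"
      by (rule integral_norm_bound_integral) (use ki C in auto)
    then show ?thesis using that by (simp add: Kdiff mult.commute)
  qed
  have Kb: "\<bar>K x\<bar> \<le> C * t" if "x \<in> {0..t}" for x
  proof -
    have "\<bar>K x\<bar> \<le> C * x" using Klip[of 0 x] that by (simp add: K_def)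
    also have "\<dots> \<le> C * t" using that C0 by (intro mult_left_mono) auto
    finally show ?thesis .
  qed
  have Kcont: "continuous_on {0..t} K"
    unfolding K_def by (rule indefinite_integral_continuous_1[OF ki])
  have kKi: "(\<lambda>w. k w * exp (K w)) integrable_on {x..y}" if "0 \<le> x" "y \<le> t" for x y
  proof (rule integrable_subinterval_real[of _ 0 t])
    show "(\<lambda>w. k w * exp (K w)) integrable_on {0..t}"
    proof (rule measurable_bounded_by_integrable_imp_integrable[where g="\<lambda>_. C * B"])
      have "k \<in> borel_measurable (lebesgue_on {0..t})"
        using k by (intro measurable_restrict_space1 measurable_completion) simp
      moreover have "(\<lambda>w. exp (K w)) \<in> borel_measurable (lebesgue_on {0..t})"
        by (intro continuous_imp_measurable_on_sets_lebesgue continuous_intros Kcont) auto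
      ultimately show "(\<lambda>w. k w * exp (K w)) \<in> borel_measurable (lebesgue_on {0..t})" by measurable
      fix w assume "w \<in> {0..t}"
      then show "norm (k w * exp (K w)) \<le> C * B"
        unfolding norm_mult using C C0 Kb[of w] by (intro mult_mono) (auto simp: B_def)
    qed auto
  qed (use that in auto)
  \<comment> \<open>Both increments in \<open>D\<close> are compared with
    \<open>exp (K x) * (K y - K x)\<close>. Each error is at most
    \<open>B * C\<^sup>2 * (y - x)\<^sup>2\<close>, since \<open>B\<close> is a Lipschitz constant
    of the exponential on the range of \<open>K\<close>, and \<open>C\<close> one of
    \<open>K\<close>.\<close>
  have Dlip: "\<bar>D y - D x\<bar> \<le> 2 * B * C\<^sup>2 * (y - x)\<^sup>2" if xy: "0 \<le> x" "x \<le> y" "y \<le> t" for x y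
  proof -
    have e: "\<bar>exp (K v) - exp (K x)\<bar> \<le> B * (C * (y - x))" if "v \<in> {x..y}" for v
    proof -
      have "\<bar>exp (K v) - exp (K x)\<bar> \<le> B * \<bar>K v - K x\<bar>"
        unfolding B_def using that xy by (intro abs_exp_diff_le Kb) auto
      also have "\<dots> \<le> B * (C * (v - x))"
        using Klip[of x v] that xy by (intro mult_left_mono) (auto simp: B_def)
      also have "\<dots> \<le> B * (C * (y - x))"
        using that C0 by (intro mult_left_mono) (auto simp: B_def)
      finally show ?thesis .
    qed
    have "\<bar>exp (K y) - exp (K x) - exp (K x) * (K y - K x)\<bar> \<le> \<bar>K y - K x\<bar> * \<bar>exp (K y) - exp (K x)\<bar>"
      by (rule abs_exp_taylor1_le)
    also have "\<dots> \<le> (C * (y - x)) * (B * (C * (y - x)))"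
      using Klip[of x y] e[of y] xy by (intro mult_mono) auto
    finally have 1: "\<bar>exp (K y) - exp (K x) - exp (K x) * (K y - K x)\<bar> \<le> (C * (y - x)) * (B * (C * (y - x)))" .
    have i: "(\<lambda>w. k w * exp (K w) - exp (K x) * k w) integrable_on {x..y}"
      using xy by (intro integrable_diff kKi integrable_on_mult_right ki) auto
    have "norm (integral {x..y} (\<lambda>w. k w * exp (K w) - exp (K x) * k w)) \<le> integral {x..y} (\<lambda>_. C * (B * (C * (y - x))))"
    proof (rule integral_norm_bound_integral[OF i])
      fix w assume w: "w \<in> {x..y}"
      have "norm (k w * exp (K w) - exp (K x) * k w) = \<bar>k w\<bar> * \<bar>exp (K w) - exp (K x)\<bar>"
        by (simp add: abs_mult[symmetric] algebra_simps)
      also have "\<dots> \<le> C * (B * (C * (y - x)))"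
        using C0 C e[OF w] by (intro mult_mono) auto
      finally show "norm (k w * exp (K w) - exp (K x) * k w) \<le> C * (B * (C * (y - x)))" .
    qed auto
    also have "integral {x..y} (\<lambda>w. k w * exp (K w) - exp (K x) * k w)
        = integral {x..y} (\<lambda>w. k w * exp (K w)) - exp (K x) * (K y - K x)"
      using xy by (subst integral_diff) (auto intro!: kKi integrable_on_mult_right ki simp: Kdiff)
    finally have 2: "\<bar>integral {x..y} (\<lambda>w. k w * exp (K w)) - exp (K x) * (K y - K x)\<bar> \<le> (y - x) * (C * (B * (C * (y - x))))"
      using xy by (simp add: ac_simps)
    have "D y - D x = (exp (K y) - exp (K x) - exp (K x) * (K y - K x))
        - (integral {x..y} (\<lambda>w. k w * exp (K w)) - exp (K x) * (K y - K x))"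
      using Henstock_Kurzweil_Integration.integral_combine[of 0 x y "\<lambda>w. k w * exp (K w)"] kKi[of 0 y] xy by (simp add: D_def)
    then show ?thesis using 1 2 by (simp add: power2_eq_square algebra_simps)
  qed
  have Dlip': "\<bar>D y - D x\<bar> \<le> 2 * B * C\<^sup>2 * (y - x)\<^sup>2" if "x \<in> {0..t}" "y \<in> {0..t}" for x y
    using Dlip[of x y] Dlip[of y x] that
    by (cases "x \<le> y") (auto simp: abs_minus_commute power2_commute)
  \<comment> \<open>The quadratic bound makes each difference quotient of \<open>D\<close> at most a
    multiple of \<open>\<bar>y - x\<bar>\<close>, so \<open>D\<close> has derivative zero and is
    constant.\<close>
  have "(D has_field_derivative 0) (at x within {0..t})" if x: "x \<in> {0..t}" for x
    unfolding has_field_derivative_def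
  proof (rule has_derivativeI_sandwich[where e=1 and H="\<lambda>y. 2 * B * C\<^sup>2 * \<bar>y - x\<bar>"])
    show "((\<lambda>y. 2 * B * C\<^sup>2 * \<bar>y - x\<bar>) \<longlongrightarrow> 0) (at x within {0..t})"
      by (auto intro!: tendsto_eq_intros)
    fix y assume y: "y \<in> {0..t}" "y \<noteq> x"
    then show "norm (D y - D x - 0 * (y - x)) / norm (y - x) \<le> 2 * B * C\<^sup>2 * \<bar>y - x\<bar>"
      using Dlip'[OF x y(1)] by (simp add: field_simps power2_eq_square)
  qed (auto intro: bounded_linear_mult_right)
  then obtain c where c: "\<And>x. x \<in> {0..t} \<Longrightarrow> D x = c"
    using has_field_derivative_zero_constant[of "{0..t}" D] by auto
  have "D 0 = 1" by (simp add: D_def K_def)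
  then have "D t = 1" using c[of 0] c[of t] t by simp
  then have "integral {0..t} (\<lambda>w. k w * exp (K w)) = exp (K t) - 1" by (simp add: D_def)
  then show ?thesis
    using kKi[of 0 t] by (simp add: K_def has_integral_integrable_integral)
qed

text \<open>(1) is the integrated form of G' = k G. In (2) the integrand is the density of the first
  point of a point process with intensity \<open>k\<close>; it is the case \<open>- k\<close> of the
  same identity.\<close>

lemma nn_integral_exp_integral:
  fixes k :: "real \<Rightarrow> real"
  assumes k: "k \<in> borel_measurable borel" and C: "\<And>v. 0 \<le> k v" "\<And>v. k v \<le> C" and t: "0 \<le> t"
  shows "(\<integral>\<^sup>+v\<in>{0..t}. ennreal (k v * exp (integral {0..v} k)) \<partial>lborel) = ennreal (exp (integral {0..t} k) - 1)"
    and "(\<integral>\<^sup>+v\<in>{0..t}. ennreal (k v * exp (- integral {0..v} k)) \<partial>lborel) = ennreal (1 - exp (- integral {0..t} k))"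
proof -
  have *: "(\<integral>\<^sup>+v\<in>{0..t}. ennreal (f v) \<partial>lborel) = ennreal I" 
    if "(f has_integral I) {0..t}" "\<And>v. 0 \<le> f v" for f I
    using nn_integral_has_integral_lebesgue[OF that(2,1)]
    by (simp add: ennreal_indicator ennreal_mult'' mult.commute)
  have a: "\<bar>k v\<bar> \<le> C" "\<bar>- k v\<bar> \<le> C" for v using C[of v] by auto
  show "(\<integral>\<^sup>+v\<in>{0..t}. ennreal (k v * exp (integral {0..v} k)) \<partial>lborel) = ennreal (exp (integral {0..t} k) - 1)"
    using C by (intro * has_integral_exp_integral k a t) auto
  have "((\<lambda>v. - k v * exp (integral {0..v} (\<lambda>w. - k w))) has_integral exp (integral {0..t} (\<lambda>w. - k w)) - 1) {0..t}"
    by (rule has_integral_exp_integral[OF _ a(2) t]) (use k in measurable)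
  from has_integral_neg[OF this]
  show "(\<integral>\<^sup>+v\<in>{0..t}. ennreal (k v * exp (- integral {0..v} k)) \<partial>lborel) = ennreal (1 - exp (- integral {0..t} k))"
    using C by (intro *) auto
qed

section \<open>Survival functions and the associated growth function\<close>

lemma nn_integral_Ico_Icc:
  fixes a b :: real
  shows "(\<integral>\<^sup>+v\<in>{a..<b}. f v \<partial>lborel) = (\<integral>\<^sup>+v\<in>{a..b}. f v \<partial>lborel)"
  by (rule nn_integral_cong_AE, rule eventually_mono[OF AE_lborel_singleton[of b]])
    (auto split: split_indicator)

locale hazard =
  fixes \<delta> :: real and p :: "real \<Rightarrow> real"
  assumes rate_pos: "0 < \<delta>" and p_borel [measurable]: "p \<in> borel_measurable borel"
    and p_nonneg: "\<And>v. 0 \<le> p v" and p_le_1: "\<And>v. p v \<le> 1"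
begin

text \<open>This is the G of the overview on the nonnegative half-line. For negative
  \<open>t\<close> the interval is empty and the value is 1 rather than 0, so later integrals cut
  off negative arguments by their domains.\<close>

definition growth :: "real \<Rightarrow> real" where
  "growth t = exp (\<delta> * integral {0..t} p)"

lemma p_integrable_on: "p integrable_on {a..b}"
  using p_borel by (rule bounded_borel_integrable_on[where C=1]) (use p_nonneg p_le_1 in \<open>auto simp: abs_of_nonneg\<close>)

lemma growth_pos: "0 < growth t"
  by (simp add: growth_def)

lemma growth_0: "growth 0 = 1"
  by (simp add: growth_def)

lemma mono_growth: "mono growth"
proof (rule monoI)
  fix s t :: real assume "s \<le> t"
  then have "integral {0..s} p \<le> integral {0..t} p"
    by (intro integral_subset_le p_integrable_on) (auto simp: p_nonneg)
  then show "growth s \<le> growth t" using rate_pos by (simp add: growth_def)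
qed

lemma growth_borel [measurable]: "growth \<in> borel_measurable borel"
  using mono_growth by (rule borel_measurable_mono)

lemma nn_integral_p: "(\<integral>\<^sup>+v\<in>{0..t}. ennreal (p v) \<partial>lborel) = ennreal (integral {0..t} p)"
  using nn_integral_has_integral_lebesgue[OF p_nonneg integrable_integral[OF p_integrable_on[of 0 t]]]
  by (simp add: ennreal_indicator ennreal_mult'' mult.commute)

lemma nn_integral_p_growth:
  assumes "0 \<le> t"
  shows "(\<integral>\<^sup>+v\<in>{0..t}. ennreal (\<delta> * p v * growth v) \<partial>lborel) = ennreal (growth t - 1)"
proof -
  have "(\<integral>\<^sup>+v\<in>{0..t}. ennreal (\<delta> * p v * exp (integral {0..v} (\<lambda>v. \<delta> * p v))) \<partial>lborel) = 
      ennreal (exp (integral {0..t} (\<lambda>v. \<delta> * p v)) - 1)"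
    by (rule nn_integral_exp_integral(1)[where C=\<delta>])
      (use assms rate_pos p_nonneg p_le_1 mult_left_mono[OF p_le_1, of \<delta>] in auto)
  then show ?thesis by (simp add: growth_def)
qed

text \<open>
  For offspring born at the points of a rate \<open>\<delta>\<close> Poisson process in \<open>[0, l)\<close>, each counted with
  weight \<open>1 - p (u - s)\<close>, \<open>tail_value u l s\<close> is the expected product of the weights of the points
  after \<open>s\<close>.
\<close>
definition weight :: "real \<Rightarrow> real \<Rightarrow> real \<Rightarrow> real" where
  "weight u l s = (if s < l then 1 - p (u - s) else 1)"

definition tail_value :: "real \<Rightarrow> real \<Rightarrow> real \<Rightarrow> real" where
  "tail_value u l s = (if s < l then growth (u - l) / growth (u - s) else 1)"

lemma weight_borel [measurable]:
  "(\<lambda>(l, s). weight u l s) \<in> borel_measurable (borel \<Otimes>\<^sub>M borel)"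
  "weight u l \<in> borel_measurable borel"
  unfolding weight_def by measurable

lemma tail_value_borel [measurable]:
  "(\<lambda>(l, s). tail_value u l s) \<in> borel_measurable (borel \<Otimes>\<^sub>M borel)"
  "tail_value u l \<in> borel_measurable borel"
  unfolding tail_value_def by measurable

lemma weight_bounds: "0 \<le> weight u l s" "weight u l s \<le> 1"
  using p_nonneg p_le_1 by (auto simp: weight_def)

lemma tail_value_bounds: "0 \<le> tail_value u l s" "tail_value u l s \<le> 1"
proof -
  have "s < l \<Longrightarrow> growth (u - l) \<le> growth (u - s)"
    using mono_growth[THEN monoD, of "u - l" "u - s"] by simp
  then show "0 \<le> tail_value u l s" "tail_value u l s \<le> 1"
    using growth_pos[of "u - s"] growth_pos[of "u - l"] by (auto simp: tail_value_def)
qed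

lemma exponential_tail:
  assumes "0 \<le> T"
  shows "(\<integral>\<^sup>+v\<in>{T..}. ennreal (\<delta> * exp (- (v * \<delta>))) \<partial>lborel) = ennreal (exp (- (T * \<delta>)))"
proof -
  have "((\<lambda>v. - exp (- (v * \<delta>))) \<longlongrightarrow> 0) at_top"
    using rate_pos by real_asymp
  then have "(\<integral>\<^sup>+v\<in>{T..}. ennreal (\<delta> * exp (- (v * \<delta>))) \<partial>lborel) = ennreal (0 - (- exp (- (T * \<delta>))))"
    by (intro nn_integral_FTC_atLeast) (auto intro!: derivative_eq_intros simp: rate_pos less_imp_le)
  then show ?thesis by simp
qed

text \<open>Let \<open>a < l\<close> and let the next point be \<open>a + v\<close>. Before
  \<open>l\<close>, the exponential density, the weight and \<open>tail_value\<close> combine into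
  \<open>growth (u - l) / growth (u - a)\<close> times
  \<open>k v * exp (- integral {0..v} k)\<close>, because
  \<open>exp (- (v * \<delta>)) / growth (u - a - v)\<close> equals
  \<open>exp (- integral {0..v} k) / growth (u - a)\<close>. Here \<open>k\<close> is the intensity
  left when a point at \<open>s\<close> is kept with probability \<open>1 - p (u - s)\<close>.
  Integrated up to \<open>T\<close>, this misses \<open>tail_value u l a\<close> by exactly the
  probability that no point falls in the remaining time \<open>T\<close>, and in that case both
  factors are 1.\<close>

lemma tail_value_fixed_point:
  assumes l: "l \<le> u"
  shows "(\<integral>\<^sup>+v. ennreal (weight u l (a + v) * tail_value u l (a + v)) \<partial>density lborel (exponential_density \<delta>))
      = ennreal (tail_value u l a)"
proof -
  define T where "T = (if a < l then l - a else 0)"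
  define c where "c = (if a < l then growth (u - l) / growth (u - a) else 1)"
  have T0: "0 \<le> T" by (simp add: T_def)
  define k where "k v = \<delta> * (1 - p (u - a - v))" for v
  have [measurable]: "k \<in> borel_measurable borel"
    unfolding k_def by measurable
  have k_bounds: "0 \<le> k v" "k v \<le> \<delta>" for v
    using rate_pos p_nonneg p_le_1 mult_left_mono[of "1 - p (u - a - v)" 1 \<delta>] by (auto simp: k_def)
  have T: "(\<integral>\<^sup>+v\<in>{0..T}. ennreal (k v * exp (- integral {0..v} k)) \<partial>lborel) = ennreal (1 - exp (- integral {0..T} k))"
    by (rule nn_integral_exp_integral(2)[where C=\<delta>]) (use T0 k_bounds in auto)
  have ik: "integral {0..v} k = \<delta> * v - \<delta> * integral {u - a - v..u - a} p" if "0 \<le> v" for v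
  proof -
    have "((\<lambda>w. p (u - a - w)) has_integral integral {u - a - v..u - a} p) {0..v}"
    proof -
      have "(\<lambda>w. - w + (u - a)) ` {u - a - v..u - a} = {0..v}"
      proof
        show "{0..v} \<subseteq> (\<lambda>w. - w + (u - a)) ` {u - a - v..u - a}"
        proof
          fix x assume "x \<in> {0..v}"
          then show "x \<in> (\<lambda>w. - w + (u - a)) ` {u - a - v..u - a}"
            by (intro image_eqI[where x="u - a - x"]) auto
        qed
      qed auto
      then show ?thesis
        using has_integral_affinity[of p "integral {u - a - v..u - a} p" "u - a - v" "u - a" "-1" "u - a"]
          p_integrable_on[of "u - a - v" "u - a"]
        by (simp add: integrable_integral)
    qed
    from has_integral_mult_right[OF has_integral_diff[OF has_integral_const_real[of 1 0 v] this], of \<delta>]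
    show ?thesis using that unfolding k_def by (simp add: integral_unique right_diff_distrib)
  qed
  have ek: "exp (- integral {0..v} k) = exp (- (v * \<delta>)) * (growth (u - a) / growth (u - a - v))"
    if "0 \<le> v" "v \<le> u - a" for v
  proof -
    have "integral {0..u - a - v} p + integral {u - a - v..u - a} p = integral {0..u - a} p"
      by (rule Henstock_Kurzweil_Integration.integral_combine) (use that p_integrable_on in auto)
    then have "growth (u - a) = growth (u - a - v) * exp (\<delta> * integral {u - a - v..u - a} p)"
      by (simp add: growth_def exp_add[symmetric] distrib_left[symmetric])
    then have "growth (u - a) / growth (u - a - v) = exp (\<delta> * integral {u - a - v..u - a} p)"
      using growth_pos[of "u - a - v"] by (simp add: field_simps)
    then show ?thesis
      using that by (simp add: ik exp_add[symmetric] mult.commute)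
  qed
  have 1: "(\<integral>\<^sup>+v\<in>{0..<T}. ennreal (exponential_density \<delta> v * (weight u l (a + v) * tail_value u l (a + v))) \<partial>lborel)
     = ennreal (tail_value u l a - exp (- (T * \<delta>)))"
  proof (cases "a < l")
    case True
    define h where "h v = exp (- (v * \<delta>)) * (growth (u - a) / growth (u - a - v))" for v
    have [measurable]: "h \<in> borel_measurable borel"
      unfolding h_def by measurable
    have h: "exp (- integral {0..v} k) = h v" if "v \<in> {0..T}" for v
      using that True l unfolding h_def by (intro ek) (auto simp: T_def)
    have "(\<integral>\<^sup>+v\<in>{0..T}. ennreal (k v * h v) \<partial>lborel) = (\<integral>\<^sup>+v\<in>{0..T}. ennreal (k v * exp (- integral {0..v} k)) \<partial>lborel)"
      by (intro nn_integral_cong) (auto split: split_indicator simp: h)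
    note T' = this[unfolded T]
    have "(\<integral>\<^sup>+v\<in>{0..<T}. ennreal (exponential_density \<delta> v * (weight u l (a + v) * tail_value u l (a + v))) \<partial>lborel)
      = (\<integral>\<^sup>+v\<in>{0..T}. ennreal (exponential_density \<delta> v * (weight u l (a + v) * tail_value u l (a + v))) \<partial>lborel)"
      by (rule nn_integral_Ico_Icc)
    \<comment> \<open>At \<open>v = T\<close> the point sits at \<open>l\<close>, where the weight
      is 1 by convention and the new formula may fail; the endpoint is therefore dropped as a null
      set.\<close>
    also have "\<dots> = (\<integral>\<^sup>+v\<in>{0..T}. ennreal (exponential_density \<delta> v * ((1 - p (u - a - v)) * (growth (u - l) / growth (u - a - v)))) \<partial>lborel)"
      unfolding nn_integral_Ico_Icc[symmetric] using True
      by (intro nn_integral_cong)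
        (auto split: split_indicator simp: T_def weight_def tail_value_def diff_diff_eq)
    also have "\<dots> = (\<integral>\<^sup>+v. ennreal (growth (u - l) / growth (u - a)) * (ennreal (k v * h v) * indicator {0..T} v) \<partial>lborel)"
    proof (intro nn_integral_cong)
      fix v
      have "exponential_density \<delta> v * ((1 - p (u - a - v)) * (growth (u - l) / growth (u - a - v)))
          = growth (u - l) / growth (u - a) * (k v * h v)" if "v \<in> {0..T}"
      proof -
        have v: "0 \<le> v" "v \<le> u - a" using that True l by (auto simp: T_def)
        show ?thesis
          using v(1) growth_pos[of "u - a"] growth_pos[of "u - a - v"]
          by (simp add: h_def k_def exponential_density_def)
      qed
      then show "ennreal (exponential_density \<delta> v * ((1 - p (u - a - v)) * (growth (u - l) / growth (u - a - v)))) * indicator {0..T} v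
          = ennreal (growth (u - l) / growth (u - a)) * (ennreal (k v * h v) * indicator {0..T} v)"
        using growth_pos[of "u - a"] growth_pos[of "u - l"]
        by (auto split: split_indicator simp: ennreal_mult'[symmetric])
    qed
    also have "\<dots> = ennreal (growth (u - l) / growth (u - a)) * ennreal (1 - exp (- integral {0..T} k))"
      by (subst nn_integral_cmult) (auto simp: T')
    also have "\<dots> = ennreal (tail_value u l a - exp (- (T * \<delta>)))"
      using True l growth_pos[of "u - l"] growth_pos[of "u - a"]
      by (simp add: ek T_def ennreal_mult'[symmetric] tail_value_def right_diff_distrib)
    finally show ?thesis .
  next
    case False
    then show ?thesis by (simp add: T_def tail_value_def)
  qed
  have 2: "(\<integral>\<^sup>+v\<in>{T..}. ennreal (exponential_density \<delta> v * (weight u l (a + v) * tail_value u l (a + v))) \<partial>lborel) = ennreal (exp (- (T * \<delta>)))"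
  proof -
    have "(\<integral>\<^sup>+v\<in>{T..}. ennreal (exponential_density \<delta> v * (weight u l (a + v) * tail_value u l (a + v))) \<partial>lborel)
       = (\<integral>\<^sup>+v\<in>{T..}. ennreal (\<delta> * exp (- (v * \<delta>))) \<partial>lborel)"
      by (intro nn_integral_cong) (auto split: split_indicator simp: exponential_density_def T_def weight_def tail_value_def algebra_simps split: if_splits)
    then show ?thesis using exponential_tail[OF T0] by simp
  qed
  have "(\<integral>\<^sup>+v. ennreal (weight u l (a + v) * tail_value u l (a + v)) \<partial>density lborel (exponential_density \<delta>))
    = (\<integral>\<^sup>+v. ennreal (exponential_density \<delta> v * (weight u l (a + v) * tail_value u l (a + v))) \<partial>lborel)"
    using rate_pos by (subst nn_integral_density) (auto simp: ennreal_mult' exponential_density_nonneg)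
  also have "\<dots> = (\<integral>\<^sup>+v. (ennreal (exponential_density \<delta> v * (weight u l (a + v) * tail_value u l (a + v))) * indicator {0..<T} v
      + ennreal (exponential_density \<delta> v * (weight u l (a + v) * tail_value u l (a + v))) * indicator {T..} v) \<partial>lborel)"
    using T0 by (intro nn_integral_cong) (auto split: split_indicator simp: exponential_density_def)
  also have "\<dots> = ennreal (tail_value u l a - exp (- (T * \<delta>))) + ennreal (exp (- (T * \<delta>)))"
    by (subst nn_integral_add) (auto simp: 1 2)
  also have "\<dots> = ennreal (tail_value u l a)"
  proof -
    \<comment> \<open>\<open>ennreal\<close> sends negative reals to 0, so recombining the two parts
      needs a nonnegative difference. For \<open>a < l\<close> this is
      \<open>exp (- integral {0..T} k) \<le> 1\<close> rewritten with the quotient of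
      \<open>growth\<close> values.\<close>
    have "exp (- (T * \<delta>)) \<le> tail_value u l a"
    proof (cases "a < l")
      case True
      have "0 \<le> integral {0..T} k" 
using k_bounds by (intro integral_nonneg bounded_borel_integrable_on[where C=\<delta>]) (auto simp: abs_of_nonneg)
      then have "exp (- integral {0..T} k) \<le> 1" by simp
      moreover have eT: "exp (- integral {0..T} k) = exp (- (T * \<delta>)) * (growth (u - a) / growth (u - l))"
        using ek[of T] True l by (simp add: T_def)
      ultimately have "exp (- (T * \<delta>)) * (growth (u - a) / growth (u - l)) \<le> 1"
        by (simp only: eT)
      then show ?thesis
        using True growth_pos[of "u - l"] growth_pos[of "u - a"] by (simp add: tail_value_def T_def field_simps)
    qed (simp add: tail_value_def T_def)
    then show ?thesis by (subst ennreal_plus[symmetric]) auto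
  qed
  finally show ?thesis .
qed
end

section \<open>Poisson points\<close>

lemma (in sequence_space) nn_integral_PiM_iter:
  assumes [measurable]: "f \<in> borel_measurable S"
  shows "(\<integral>\<^sup>+w. f w \<partial>S) = (\<integral>\<^sup>+v. \<integral>\<^sup>+w. f (case_nat v w) \<partial>S \<partial>M)"
proof -
  have "(\<integral>\<^sup>+w. f w \<partial>S) = (\<integral>\<^sup>+x. f ((\<lambda>(s, \<omega>). case_nat s \<omega>) x) \<partial>(M \<Otimes>\<^sub>M S))"
    by (subst PiM_iter[symmetric]) (simp add: nn_integral_distr)
  also have "\<dots> = (\<integral>\<^sup>+v. \<integral>\<^sup>+w. f ((\<lambda>(s, \<omega>). case_nat s \<omega>) (v, w)) \<partial>S \<partial>M)"
    by (subst nn_integral_fst) simp_all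
  finally show ?thesis by simp
qed

abbreviation exponential :: "real \<Rightarrow> real measure" where
  "exponential r \<equiv> density lborel (exponential_density r)"

abbreviation waiting_times :: "real \<Rightarrow> (nat \<Rightarrow> real) measure" where
  "waiting_times r \<equiv> \<Pi>\<^sub>M n\<in>UNIV. exponential r"

lemma sequence_space_exponential: "0 < r \<Longrightarrow> sequence_space (exponential r)"
  unfolding sequence_space_def product_prob_space_def product_prob_space_axioms_def product_sigma_finite_def
  by (auto intro!: prob_space_exponential_density prob_space_imp_sigma_finite)

lemma indep_vars_PiM_components:
  assumes "\<And>i. i \<in> I \<Longrightarrow> prob_space (P i)" "I \<noteq> {}"
  shows "prob_space.indep_vars (PiM I P) P (\<lambda>i x. x i) I"
proof -
  interpret prob_space "PiM I P" by (intro prob_space_PiM assms)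
  have "distr (PiM I P) (PiM I P) (\<lambda>x. \<lambda>i\<in>I. x i) = distr (PiM I P) (PiM I P) (\<lambda>x. x)"
    by (intro distr_cong) (auto simp: space_PiM PiE_def extensional_restrict)
  also have "\<dots> = PiM I (\<lambda>i. distr (PiM I P) (P i) (\<lambda>x. x i))"
    by (subst distr_id) (auto intro!: PiM_cong simp: distr_PiM_component assms)
  finally show ?thesis
    by (subst indep_vars_iff_distr_eq_PiM') (auto simp: assms)
qed

text \<open>Each summand is the density of one point of the process, so the sum is the intensity;
  analytically it is the exponential series.\<close>

lemma erlang_density_sums:
  assumes "0 < x"
  shows "(\<lambda>n. erlang_density n r x) sums r"
proof -
  have "(\<lambda>n. r * exp (- r * x) * ((r * x) ^ n /\<^sub>R fact n)) sums (r * exp (- r * x) * exp (r * x))"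
    by (intro sums_mult exp_converges)
  then show ?thesis
    using assms by (simp add: erlang_density_def field_simps exp_minus power_mult_distrib)
qed

text \<open>The sum of these probabilities is the mean number of points before \<open>l\<close>. It
  serves twice: it makes the n-th probability tend to 0, and it gives the mean number of
  children.\<close>

lemma expected_arrivals:
  assumes r: "0 < r"
  shows "(\<Sum>n. emeasure (waiting_times r) {w \<in> space (waiting_times r). sum w {..n} < l}) = ennreal (r * l)"
proof -
  interpret sequence_space "exponential r" using r by (rule sequence_space_exponential)
  have ind: "indep_vars (\<lambda>_. borel) (\<lambda>i w. w i) (UNIV :: nat set)"
    using indep_vars_PiM_components[where I="UNIV :: nat set" and P="\<lambda>_. exponential r", OF prob_space_exponential_density[OF r]]
    unfolding P.indep_vars_def2 by simp
  have dist: "distributed S lborel (\<lambda>w. w i) (exponential_density r)" for i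
    unfolding distributed_def using distr_PiM_component[of UNIV "\<lambda>_. exponential r" i] prob_space_exponential_density[OF r]
    by (auto simp: cong: distr_cong)
  \<comment> \<open>\<open>erlang_density n\<close> has shape n + 1, the number of waiting times in
    \<open>{..n}\<close>.\<close>
  have er: "distributed S lborel (\<lambda>w. sum w {..n}) (erlang_density n r)" for n
    using P.exponential_distributed_sum[of "{..n}" r "\<lambda>i w. w i"] r dist P.indep_vars_subset[OF ind] by auto
  have "emeasure S {w \<in> space S. sum w {..n} < l} = (\<integral>\<^sup>+x. ennreal (erlang_density n r x) * indicator {..<l} x \<partial>lborel)" for n
    using distributed_emeasure[OF er, of "{..<l}"] by (simp add: vimage_def Int_def conj_commute)
  then have "(\<Sum>n. emeasure S {w \<in> space S. sum w {..n} < l}) = (\<integral>\<^sup>+x. (\<Sum>n. ennreal (erlang_density n r x) * indicator {..<l} x) \<partial>lborel)"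
    by (subst nn_integral_suminf) auto
  also have "\<dots> = (\<integral>\<^sup>+x. ennreal r * indicator {0<..<l} x \<partial>lborel)"
  proof (intro nn_integral_cong_AE, rule eventually_mono[OF AE_lborel_singleton[of 0]])
    fix x :: real assume "x \<noteq> 0"
    show "(\<Sum>n. ennreal (erlang_density n r x) * indicator {..<l} x) = ennreal r * indicator {0<..<l} x"
    proof (cases "0 < x")
      case True
      then have "(\<Sum>n. ennreal (erlang_density n r x)) = ennreal r"
        using r by (intro suminf_ennreal_eq erlang_density_sums) auto
      with True show ?thesis by (simp split: split_indicator)
    qed (use \<open>x \<noteq> 0\<close> in \<open>auto simp: erlang_density_def\<close>)
  qed
  also have "\<dots> = ennreal (r * l)"
    using r by (cases "0 \<le> l") (auto simp: nn_integral_cmult ennreal_mult'[symmetric] ennreal_neg mult_nonneg_nonpos)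
  finally show ?thesis .
qed

context hazard begin

text \<open>Induction with \<open>a\<close> free: the first waiting time moves the starting point to
  \<open>a + v\<close>, the others form an independent sequence of the same law, and
  \<open>tail_value_fixed_point\<close> absorbs the first weight.\<close>

lemma prod_weight_tail_value:
  assumes l: "l \<le> u"
  shows "(\<integral>\<^sup>+w. ennreal ((\<Prod>i<n. weight u l (a + sum w {..i})) * tail_value u l (a + sum w {..<n})) \<partial>waiting_times \<delta>)
      = ennreal (tail_value u l a)"
proof (induction n arbitrary: a)
  case 0
  interpret sequence_space "exponential \<delta>" using rate_pos by (rule sequence_space_exponential)
  show ?case by (simp add: P.emeasure_space_1)
next
  case (Suc n)
  interpret sequence_space "exponential \<delta>" using rate_pos by (rule sequence_space_exponential)
  have "(\<integral>\<^sup>+w. ennreal ((\<Prod>i<Suc n. weight u l (a + sum w {..i})) * tail_value u l (a + sum w {..<Suc n})) \<partial>S)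
    = (\<integral>\<^sup>+v. \<integral>\<^sup>+w. ennreal ((\<Prod>i<Suc n. weight u l (a + sum (case_nat v w) {..i})) * tail_value u l (a + sum (case_nat v w) {..<Suc n})) \<partial>S \<partial>exponential \<delta>)"
    by (rule nn_integral_PiM_iter) measurable
  also have "\<dots> = (\<integral>\<^sup>+v. \<integral>\<^sup>+w. ennreal (weight u l (a + v)) * ennreal ((\<Prod>i<n. weight u l (a + v + sum w {..i})) * tail_value u l (a + v + sum w {..<n})) \<partial>S \<partial>exponential \<delta>)"
    by (intro nn_integral_cong)
      (simp add: prod.lessThan_Suc_shift sum.atMost_Suc_shift sum.lessThan_Suc_shift weight_bounds ennreal_mult'[symmetric] mult.assoc add.assoc
        del: prod.lessThan_Suc sum.lessThan_Suc sum.atMost_Suc)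
  also have "\<dots> = (\<integral>\<^sup>+v. ennreal (weight u l (a + v)) * ennreal (tail_value u l (a + v)) \<partial>exponential \<delta>)"
    by (subst nn_integral_cmult) (measurable, simp add: Suc.IH)
  also have "\<dots> = ennreal (tail_value u l a)"
    using tail_value_fixed_point[OF l] by (simp add: weight_bounds ennreal_mult'[symmetric])
  finally show ?case .
qed

lemma tail_value_le_expected_prod_weight:
  assumes l: "l \<le> u"
  shows "ennreal (tail_value u l 0) \<le> (\<integral>\<^sup>+w. ennreal (\<Prod>i<n. weight u l (sum w {..i})) \<partial>waiting_times \<delta>)"
proof -
  have "ennreal (tail_value u l 0)
      = (\<integral>\<^sup>+w. ennreal ((\<Prod>i<n. weight u l (sum w {..i})) * tail_value u l (sum w {..<n})) \<partial>waiting_times \<delta>)"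
    using prod_weight_tail_value[OF l, where n=n and a=0] by simp
  also have "\<dots> \<le> (\<integral>\<^sup>+w. ennreal (\<Prod>i<n. weight u l (sum w {..i})) \<partial>waiting_times \<delta>)"
    by (intro nn_integral_mono ennreal_leI mult_left_le prod_nonneg) (auto simp: tail_value_bounds weight_bounds)
  finally show ?thesis .
qed

text \<open>Once the point \<open>sum w {..n}\<close> is at or beyond \<open>l\<close>,
  \<open>tail_value\<close> there is 1 and may be dropped from the exact identity. Otherwise the
  product is at most 1, which costs the probability that this point falls before
  \<open>l\<close>.\<close>

lemma expected_prod_weight_le:
  assumes l: "l \<le> u"
  shows "(\<integral>\<^sup>+w. ennreal (\<Prod>i<Suc n. weight u l (sum w {..i})) \<partial>waiting_times \<delta>)
    \<le> ennreal (tail_value u l 0) + emeasure (waiting_times \<delta>) {w \<in> space (waiting_times \<delta>). sum w {..n} < l}"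
proof -
  have "(\<integral>\<^sup>+w. ennreal (\<Prod>i<Suc n. weight u l (sum w {..i})) \<partial>waiting_times \<delta>)
     \<le> (\<integral>\<^sup>+w. ennreal ((\<Prod>i<Suc n. weight u l (sum w {..i})) * tail_value u l (sum w {..<Suc n}))
          + indicator {w \<in> space (waiting_times \<delta>). sum w {..n} < l} w \<partial>waiting_times \<delta>)"
  proof (rule nn_integral_mono)
    fix w assume w: "w \<in> space (waiting_times \<delta>)"
    have "(\<Prod>i<Suc n. weight u l (sum w {..i})) \<le> 1"
      by (intro prod_le_1) (auto simp: weight_bounds)
    then show "ennreal (\<Prod>i<Suc n. weight u l (sum w {..i})) \<le> ennreal ((\<Prod>i<Suc n. weight u l (sum w {..i})) * tail_value u l (sum w {..<Suc n}))
          + indicator {w \<in> space (waiting_times \<delta>). sum w {..n} < l} w"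
      using w by (cases "sum w {..n} < l") (auto simp: tail_value_def lessThan_Suc_atMost ennreal_le_1 intro: add_increasing simp del: prod.lessThan_Suc)
  qed
  also have "\<dots> = (\<integral>\<^sup>+w. ennreal ((\<Prod>i<Suc n. weight u l (sum w {..i})) * tail_value u l (sum w {..<Suc n})) \<partial>waiting_times \<delta>)
      + (\<integral>\<^sup>+w. indicator {w \<in> space (waiting_times \<delta>). sum w {..n} < l} w \<partial>waiting_times \<delta>)"
    by (rule nn_integral_add) measurable
  also have "\<dots> = ennreal (tail_value u l 0) + emeasure (waiting_times \<delta>) {w \<in> space (waiting_times \<delta>). sum w {..n} < l}"
    using prod_weight_tail_value[OF l, where n="Suc n" and a=0] by (simp del: prod.lessThan_Suc sum.lessThan_Suc)
  finally show ?thesis .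
qed

end

section \<open>Trees and the branching property\<close>

type_synonym node = "real \<times> (nat \<Rightarrow> real)"

abbreviation node_space :: "node measure" where
  "node_space \<equiv> borel \<Otimes>\<^sub>M (\<Pi>\<^sub>M n\<in>UNIV. borel)"

abbreviation tree_space :: "(nat list \<Rightarrow> node) measure" where
  "tree_space \<equiv> \<Pi>\<^sub>M x\<in>UNIV. node_space"

abbreviation life :: "nat list \<Rightarrow> (nat list \<Rightarrow> node) \<Rightarrow> real" where
  "life x Z \<equiv> fst (Z x)"

abbreviation birth :: "nat list \<Rightarrow> nat \<Rightarrow> (nat list \<Rightarrow> node) \<Rightarrow> real" where
  "birth x n Z \<equiv> snd (Z x) n"

text \<open>Labels put the latest generation first, so the root's child \<open>n\<close> and its
  descendants are the labels ending in \<open>n\<close>; appending \<open>[n]\<close> re-roots the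
  tree at that child.\<close>

definition subtree :: "nat \<Rightarrow> (nat list \<Rightarrow> 'a) \<Rightarrow> nat list \<Rightarrow> 'a" where
  "subtree n Z x = Z (x @ [n])"

text \<open>Everything of interest depends on the sample point only through the family of pairs of
  life-length and birth points. On the right \<open>life\<close> and \<open>birth\<close> are
  coordinate maps on tree space, so only the law of this family matters.\<close>

lemma birth_time_tree: "birth_time S x \<omega> = birth_time birth x (\<lambda>x. (L x \<omega>, \<lambda>n. S x n \<omega>))"
  by (induction x) auto

lemma born_tree: "born L S x \<omega> = born life birth x (\<lambda>x. (L x \<omega>, \<lambda>n. S x n \<omega>))"
  by (induction x) auto

lemma alive_tree: "alive L S u \<omega> = alive life birth u (\<lambda>x. (L x \<omega>, \<lambda>n. S x n \<omega>))"
  unfolding alive_def birth_time_tree[of S _ \<omega> L] born_tree[of L S _ \<omega>] by simp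

lemma birth_time_subtree: "birth_time birth (x @ [n]) Z = birth [] n Z + birth_time birth x (subtree n Z)"
  by (induction x) (auto simp: subtree_def)

lemma born_subtree: "born life birth (x @ [n]) Z \<longleftrightarrow> birth [] n Z < life [] Z \<and> born life birth x (subtree n Z)"
  by (induction x) (auto simp: subtree_def)

lemma alive_subtree:
  "x @ [n] \<in> alive life birth u Z \<longleftrightarrow>
    birth [] n Z < life [] Z \<and> x \<in> alive life birth (u - birth [] n Z) (subtree n Z)"
  by (auto simp: alive_def birth_time_subtree born_subtree) (auto simp: subtree_def)

text \<open>Every nonempty label has the form \<open>x @ [n]\<close> and thus belongs to the subtree
  of one child of the root; for \<open>0 \<le> u\<close> the root itself can be missing only by
  having died.\<close>

lemma alive_eq_empty_iff:
  assumes "0 \<le> u"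
  shows "alive life birth u Z = {} \<longleftrightarrow> life [] Z \<le> u \<and>
    (\<forall>n. birth [] n Z < life [] Z \<longrightarrow> alive life birth (u - birth [] n Z) (subtree n Z) = {})"
proof -
  have "alive life birth u Z = {} \<longleftrightarrow> [] \<notin> alive life birth u Z \<and> (\<forall>n x. x @ [n] \<notin> alive life birth u Z)"
    by (metis all_not_in_conv rev_exhaust)
  also have "[] \<notin> alive life birth u Z \<longleftrightarrow> life [] Z \<le> u"
    using assms by (auto simp: alive_def)
  finally show ?thesis unfolding alive_subtree by blast
qed

section \<open>Joint measurability in time and tree\<close>

lemma birth_time_measurable [measurable]: "(\<lambda>Z. birth_time birth x Z) \<in> borel_measurable tree_space"
proof (induction x)
  case (Cons n x)
  note Cons [measurable]
  show ?case unfolding birth_time.simps by measurable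
qed simp

lemma born_measurable [measurable]: "Measurable.pred tree_space (\<lambda>Z. born life birth x Z)"
proof (induction x)
  case (Cons n x)
  note Cons [measurable]
  show ?case unfolding born.simps by measurable
qed simp

lemma mem_alive_measurable [measurable]:
  "Measurable.pred (borel \<Otimes>\<^sub>M tree_space) (\<lambda>(u, Z). x \<in> alive life birth u Z)"
  unfolding alive_def mem_Collect_eq by measurable

lemma alive_empty_measurable [measurable]:
  "Measurable.pred (borel \<Otimes>\<^sub>M tree_space) (\<lambda>(u, Z). alive life birth u Z = {})"
proof -
  have "Measurable.pred (borel \<Otimes>\<^sub>M tree_space) (\<lambda>(u, Z). \<forall>x. \<not> x \<in> alive life birth u Z)"
    by measurable
  moreover have "A = {} \<longleftrightarrow> (\<forall>x. \<not> x \<in> A)" for A :: "nat list set" by auto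
  ultimately show ?thesis by (simp only:)
qed

text \<open>A distinct list of length \<open>K\<close> witnesses finiteness and cardinality
  together. Lists of labels are countable, so the right-hand side is built by countable operations
  from the events that \<open>x\<close> is alive.\<close>

lemma population_eq_enat_iff:
  "population L S u \<omega> = enat K \<longleftrightarrow> (\<exists>xs. distinct xs \<and> length xs = K \<and> (\<forall>x. x \<in> alive L S u \<omega> \<longleftrightarrow> x \<in> set xs))"
  (is "_ \<longleftrightarrow> ?R")
proof
  assume "population L S u \<omega> = enat K"
  then have "finite (alive L S u \<omega>)" and card: "card (alive L S u \<omega>) = K"
    by (auto simp: population_def split: if_splits)
  then obtain xs where "set xs = alive L S u \<omega>" "distinct xs"
    using finite_distinct_list by blast
  with card show ?R
    by (intro exI[of _ xs]) (simp add: distinct_card[symmetric])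
next
  assume ?R
  then obtain xs where xs: "distinct xs" "length xs = K" "alive L S u \<omega> = set xs"
    by (auto simp: set_eq_iff)
  then show "population L S u \<omega> = enat K"
    by (simp add: population_def distinct_card)
qed

lemma population_measurable [measurable]:
  "Measurable.pred (borel \<Otimes>\<^sub>M tree_space) (\<lambda>(u, Z). population life birth u Z = enat K)"
proof -
  have [measurable]: "Measurable.pred (borel \<Otimes>\<^sub>M tree_space) (\<lambda>p. x \<in> alive life birth (fst p) (snd p))" for x
    using mem_alive_measurable[of x] by (simp add: case_prod_beta')
  have *: "Measurable.pred (borel \<Otimes>\<^sub>M tree_space) (\<lambda>p. x \<in> alive life birth (fst p) (snd p) \<longleftrightarrow> b)" for x b
    by (cases b) simp_all
  have "Measurable.pred (borel \<Otimes>\<^sub>M tree_space)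
      (\<lambda>p. \<exists>xs. distinct xs \<and> length xs = K \<and> (\<forall>x. x \<in> alive life birth (fst p) (snd p) \<longleftrightarrow> x \<in> set xs))"
    by (intro pred_intros_countable(2) pred_intros_logic(3) measurable_const * pred_intros_countable(1)) auto
  then show ?thesis
    by (simp add: population_eq_enat_iff case_prod_beta')
qed

text \<open>The sets \<open>{[]}\<close> and \<open>range (\<lambda>x. x @ [n])\<close> partition
  the labels, so the root value and the subtrees are functions of disjoint blocks of independent
  coordinates. Each block \<open>range (\<lambda>x. x @ [n])\<close> is an injective copy of all
  labels, so a subtree has the law of the whole tree.\<close>

lemma distr_PiM_branching:
  fixes \<nu> :: "'a measure"
  assumes \<nu>: "prob_space \<nu>"
  shows "distr (\<Pi>\<^sub>M x\<in>UNIV. \<nu>) (\<nu> \<Otimes>\<^sub>M (\<Pi>\<^sub>M n\<in>UNIV. \<Pi>\<^sub>M x\<in>UNIV. \<nu>)) (\<lambda>Z. (Z [], \<lambda>n. subtree n Z))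
    = \<nu> \<Otimes>\<^sub>M (\<Pi>\<^sub>M n\<in>UNIV. \<Pi>\<^sub>M x\<in>UNIV. \<nu>)"
proof -
  let ?P = "\<Pi>\<^sub>M x\<in>(UNIV :: nat list set). \<nu>"
  interpret prob_space ?P by (intro prob_space_PiM \<nu>)
  have ind: "indep_vars (\<lambda>_. \<nu>) (\<lambda>x Z. Z x) (UNIV :: nat list set)"
    by (rule indep_vars_PiM_components) (auto simp: \<nu>)
  have sub_meas: "(\<lambda>R. \<lambda>x. R (x @ [n])) \<in> PiM B (\<lambda>_. \<nu>) \<rightarrow>\<^sub>M ?P" if "range (\<lambda>x. x @ [n]) \<subseteq> B" for n :: nat and B
    using that by (intro measurable_PiM_single') (auto simp: space_PiM PiE_def Pi_def intro!: measurable_component_singleton)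
  have sub_rv: "subtree n \<in> ?P \<rightarrow>\<^sub>M ?P" for n
    using sub_meas[of n UNIV] by (simp add: subtree_def[abs_def])
  have sub_law: "distr ?P ?P (subtree n) = ?P" for n
    using distr_PiM_reindex[of UNIV "\<lambda>_. \<nu>" "\<lambda>x. x @ [n]" UNIV] \<nu>
    by (auto simp: subtree_def[abs_def] inj_on_def restrict_def)
  define K where "K n = range (\<lambda>x. x @ [n])" for n :: nat
  have "indep_vars (\<lambda>n. PiM (K n) (\<lambda>_. \<nu>)) (\<lambda>n Z. restrict (\<lambda>x. Z x) (K n)) UNIV"
    by (rule indep_vars_restrict[OF ind]) (auto simp: disjoint_family_on_def K_def)
  then have "indep_vars (\<lambda>n. ?P) (\<lambda>n Z. (\<lambda>R x. R (x @ [n])) (restrict (\<lambda>x. Z x) (K n))) UNIV"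
    by (rule indep_vars_compose2) (rule sub_meas, simp add: K_def)
  then have "indep_vars (\<lambda>n. ?P) subtree (UNIV :: nat set)"
    by (simp add: subtree_def[abs_def] K_def)
  then have subs: "distr ?P (\<Pi>\<^sub>M n\<in>UNIV. ?P) (\<lambda>Z. \<lambda>n. subtree n Z) = (\<Pi>\<^sub>M n\<in>UNIV. ?P)"
    by (subst (asm) indep_vars_iff_distr_eq_PiM) (auto simp: sub_law sub_rv restrict_def)
  \<comment> \<open>Joint independence of the subtrees is \<open>subs\<close>. What remains is
    independence of the root from all of them together: they are a function \<open>?g\<close> of the
    coordinates off \<open>{[]}\<close>.\<close>
  let ?A = "PiM {[]} (\<lambda>_ :: nat list. \<nu>)" and ?B = "PiM (- {[]}) (\<lambda>_ :: nat list. \<nu>)"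
  let ?a = "\<lambda>Z :: nat list \<Rightarrow> 'a. restrict Z {[]}" and ?b = "\<lambda>Z :: nat list \<Rightarrow> 'a. restrict Z (- {[]})"
  let ?f = "\<lambda>R :: nat list \<Rightarrow> 'a. R []" and ?g = "\<lambda>(R :: nat list \<Rightarrow> 'a) (n :: nat) x. R (x @ [n])"
  have ab: "distr ?P ?A ?a \<Otimes>\<^sub>M distr ?P ?B ?b = distr ?P (?A \<Otimes>\<^sub>M ?B) (\<lambda>Z. (?a Z, ?b Z))"
    and a [measurable]: "?a \<in> ?P \<rightarrow>\<^sub>M ?A" and b [measurable]: "?b \<in> ?P \<rightarrow>\<^sub>M ?B"
    using indep_var_restrict[OF ind, of "{[]}" "- {[]}"] unfolding indep_var_distribution_eq by auto
  have f [measurable]: "?f \<in> ?A \<rightarrow>\<^sub>M \<nu>"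
    by (rule measurable_component_singleton) simp
  have g [measurable]: "?g \<in> ?B \<rightarrow>\<^sub>M (\<Pi>\<^sub>M n\<in>UNIV. ?P)"
  proof (rule measurable_PiM_single')
    show "(\<lambda>R x. R (x @ [n])) \<in> ?B \<rightarrow>\<^sub>M ?P" for n
      by (rule sub_meas) auto
  qed (auto simp: space_PiM PiE_def Pi_def)
  have fa: "distr (distr ?P ?A ?a) \<nu> ?f = \<nu>"
    using distr_PiM_component[of "UNIV :: nat list set" "\<lambda>_. \<nu>" "[]"] \<nu> by (subst distr_distr) (auto simp: comp_def f a)
  have gb: "distr (distr ?P ?B ?b) (\<Pi>\<^sub>M n\<in>UNIV. ?P) ?g = (\<Pi>\<^sub>M n\<in>UNIV. ?P)"
    using subs by (subst distr_distr) (auto simp: comp_def g b subtree_def[abs_def])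
  interpret D: prob_space "\<Pi>\<^sub>M n\<in>(UNIV :: nat set). ?P" by (intro prob_space_PiM \<nu>)
  have "\<nu> \<Otimes>\<^sub>M (\<Pi>\<^sub>M n\<in>UNIV. ?P)
      = distr (distr ?P ?A ?a \<Otimes>\<^sub>M distr ?P ?B ?b) (\<nu> \<Otimes>\<^sub>M (\<Pi>\<^sub>M n\<in>UNIV. ?P)) (\<lambda>(x, y). (?f x, ?g y))"
    by (subst pair_measure_distr[symmetric]) (auto simp: fa gb f g D.sigma_finite_measure_axioms)
  also have "\<dots> = distr ?P (\<nu> \<Otimes>\<^sub>M (\<Pi>\<^sub>M n\<in>UNIV. ?P)) ((\<lambda>(x, y). (?f x, ?g y)) \<circ> (\<lambda>Z. (?a Z, ?b Z)))"
    unfolding ab by (rule distr_distr) measurable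
  also have "(\<lambda>(x, y). (?f x, ?g y)) \<circ> (\<lambda>Z. (?a Z, ?b Z)) = (\<lambda>Z. (Z [], \<lambda>n. subtree n Z))"
    by (auto simp: fun_eq_iff subtree_def)
  finally show ?thesis by simp
qed

lemma nn_integral_PiM_branching:
  fixes \<nu> :: "'a measure"
  assumes \<nu>: "prob_space \<nu>"
    and f: "f \<in> borel_measurable (\<nu> \<Otimes>\<^sub>M (\<Pi>\<^sub>M n\<in>UNIV. \<Pi>\<^sub>M x\<in>UNIV. \<nu>))"
  shows "(\<integral>\<^sup>+Z. f (Z [], \<lambda>n. subtree n Z) \<partial>(\<Pi>\<^sub>M x\<in>UNIV. \<nu>))
    = (\<integral>\<^sup>+z. \<integral>\<^sup>+Y. f (z, Y) \<partial>(\<Pi>\<^sub>M n\<in>UNIV. \<Pi>\<^sub>M x\<in>UNIV. \<nu>) \<partial>\<nu>)"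
proof -
  let ?P = "\<Pi>\<^sub>M x\<in>(UNIV :: nat list set). \<nu>"
  let ?D = "\<Pi>\<^sub>M n\<in>(UNIV :: nat set). ?P"
  interpret D: prob_space ?D by (intro prob_space_PiM \<nu>)
  have m: "(\<lambda>Z. (Z [], \<lambda>n. subtree n Z)) \<in> ?P \<rightarrow>\<^sub>M \<nu> \<Otimes>\<^sub>M ?D"
    unfolding subtree_def
    by (intro measurable_Pair measurable_PiM_single' measurable_component_singleton) (auto simp: space_PiM PiE_def Pi_def)
  have "(\<integral>\<^sup>+z. \<integral>\<^sup>+Y. f (z, Y) \<partial>?D \<partial>\<nu>) = integral\<^sup>N (distr ?P (\<nu> \<Otimes>\<^sub>M ?D) (\<lambda>Z. (Z [], \<lambda>n. subtree n Z))) f"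
    unfolding distr_PiM_branching[OF \<nu>] using f by (rule D.nn_integral_fst)
  also have "\<dots> = (\<integral>\<^sup>+Z. f (Z [], \<lambda>n. subtree n Z) \<partial>?P)"
    using f by (intro nn_integral_distr m) simp
  finally show ?thesis by simp
qed

section \<open>Integrating the survival function\<close>

context hazard begin

text \<open>Integrating \<open>renewal\<close> over \<open>{0..t}\<close>, exchanging the integrals
  and shifting by \<open>l\<close> turns its left side into the mean of \<open>I l\<close>, the part
  of \<open>J\<close> up to \<open>t - l\<close>. Since \<delta> G = \<delta> p G + \<delta> (1 - p)
  G and \<delta> p G integrates to \<open>growth t - 1\<close>, only the window \<open>R l\<close>
  of the last \<open>l\<close> time units remains.\<close>

lemma growth_excess:
  assumes law: "prob_space law" "sets law = sets borel" "AE l in law. 0 < l"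
    and renewal: "\<And>u. 0 \<le> u \<Longrightarrow> ennreal ((1 - p u) * growth u) = (\<integral>\<^sup>+l\<in>{..u}. ennreal (growth (u - l)) \<partial>law)"
    and t: "0 \<le> t"
  shows "ennreal (growth t - 1) = ennreal \<delta> * (\<integral>\<^sup>+l. (\<integral>\<^sup>+v\<in>{0..t} \<inter> {t - l<..}. ennreal (growth v) \<partial>lborel) \<partial>law)"
proof -
  interpret law: prob_space law by fact
  interpret P: pair_sigma_finite lborel law ..
  note law(2)[measurable_cong]
  define J where "J = (\<integral>\<^sup>+v\<in>{0..t}. ennreal (growth v) \<partial>lborel)"
  define I where "I l = (\<integral>\<^sup>+v\<in>{0..t - l}. ennreal (growth v) \<partial>lborel)" for l
  define R where "R l = (\<integral>\<^sup>+v\<in>{0..t} \<inter> {t - l<..}. ennreal (growth v) \<partial>lborel)" for l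
  have [measurable]: "Measurable.pred (borel \<Otimes>\<^sub>M borel) (\<lambda>x :: real \<times> real. snd x \<in> {0..t - fst x})"
      "Measurable.pred (borel \<Otimes>\<^sub>M borel) (\<lambda>x :: real \<times> real. snd x \<in> {0..t} \<inter> {t - fst x<..})"
      "Measurable.pred (borel \<Otimes>\<^sub>M borel) (\<lambda>x :: real \<times> real. snd x \<in> {..fst x})"
    unfolding atLeastAtMost_iff Int_iff greaterThan_iff atMost_iff by measurable
  have [measurable]: "I \<in> borel_measurable borel" "R \<in> borel_measurable borel"
    unfolding I_def R_def by measurable
  have IR: "J = I l + R l" if "0 < l" for l
  proof -
    have "J = (\<integral>\<^sup>+v. (ennreal (growth v) * indicator {0..t - l} v + ennreal (growth v) * indicator ({0..t} \<inter> {t - l<..}) v) \<partial>lborel)"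
      unfolding J_def using that by (intro nn_integral_cong) (auto split: split_indicator)
    also have "\<dots> = I l + R l" unfolding I_def R_def by (rule nn_integral_add) auto
    finally show ?thesis .
  qed
  have "J = (\<integral>\<^sup>+l. J \<partial>law)" by (simp add: law.emeasure_space_1)
  also have "\<dots> = (\<integral>\<^sup>+l. I l + R l \<partial>law)"
    using law(3) by (intro nn_integral_cong_AE) (auto simp: IR)
  also have "\<dots> = (\<integral>\<^sup>+l. I l \<partial>law) + (\<integral>\<^sup>+l. R l \<partial>law)"
    by (rule nn_integral_add) auto
  finally have J: "J = (\<integral>\<^sup>+l. I l \<partial>law) + (\<integral>\<^sup>+l. R l \<partial>law)" .
  \<comment> \<open>Cancelling the mean of \<open>I\<close> in \<open>ennreal\<close> at the end
    requires it to be finite; monotonicity of \<open>growth\<close> bounds \<open>J\<close> by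
    \<open>growth t * t\<close>.\<close>
  have "J \<le> (\<integral>\<^sup>+v. ennreal (growth t) * indicator {0..t} v \<partial>lborel)"
    unfolding J_def by (intro nn_integral_mono) (auto split: split_indicator intro!: ennreal_leI monoD[OF mono_growth])
  also have "\<dots> < \<infinity>" using t growth_pos[of t] by (simp add: nn_integral_cmult ennreal_mult'[symmetric])
  finally have Jfin: "J < \<infinity>" .
  then have Ifin: "(\<integral>\<^sup>+l. I l \<partial>law) < \<infinity>"
    unfolding J by (auto simp: less_top)
  have "(\<integral>\<^sup>+u\<in>{0..t}. ennreal ((1 - p u) * growth u) \<partial>lborel)
    = (\<integral>\<^sup>+u. \<integral>\<^sup>+l. ennreal (growth (u - l)) * indicator {..u} l * indicator {0..t} u \<partial>law \<partial>lborel)"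
    by (intro nn_integral_cong) (auto split: split_indicator simp: renewal)
  also have "\<dots> = (\<integral>\<^sup>+l. \<integral>\<^sup>+u. ennreal (growth (u - l)) * indicator {..u} l * indicator {0..t} u \<partial>lborel \<partial>law)"
    by (rule P.Fubini'[symmetric]) measurable
  also have "\<dots> = (\<integral>\<^sup>+l. I l \<partial>law)"
  proof (intro nn_integral_cong_AE, rule eventually_mono[OF law(3)])
    fix l :: real assume "0 < l"
    have [measurable]: "Measurable.pred borel (\<lambda>u. l \<in> {..u})" by simp
    have "(\<integral>\<^sup>+u. ennreal (growth (u - l)) * indicator {..u} l * indicator {0..t} u \<partial>lborel)
       = ennreal \<bar>1\<bar> * (\<integral>\<^sup>+v. ennreal (growth (l + 1 * v - l)) * indicator {..l + 1 * v} l * indicator {0..t} (l + 1 * v) \<partial>lborel)"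
      by (rule nn_integral_real_affine) measurable
    also have "\<dots> = I l"
      unfolding I_def using \<open>0 < l\<close> by (simp, intro nn_integral_cong) (auto split: split_indicator)
    finally show "(\<integral>\<^sup>+u. ennreal (growth (u - l)) * indicator {..u} l * indicator {0..t} u \<partial>lborel) = I l" .
  qed
  finally have q: "(\<integral>\<^sup>+u\<in>{0..t}. ennreal ((1 - p u) * growth u) \<partial>lborel) = (\<integral>\<^sup>+l. I l \<partial>law)" .
  have "ennreal \<delta> * J = (\<integral>\<^sup>+v. (ennreal (\<delta> * p v * growth v) * indicator {0..t} v + ennreal \<delta> * (ennreal ((1 - p v) * growth v) * indicator {0..t} v)) \<partial>lborel)"
    unfolding J_def using rate_pos p_nonneg p_le_1 growth_pos
    by (subst nn_integral_cmult[symmetric], simp, intro nn_integral_cong)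
      (auto split: split_indicator simp: ennreal_mult'[symmetric] less_imp_le ennreal_plus[symmetric] algebra_simps simp del: ennreal_plus)
  also have "\<dots> = ennreal (growth t - 1) + ennreal \<delta> * (\<integral>\<^sup>+l. I l \<partial>law)"
    by (subst nn_integral_add) (auto simp: nn_integral_cmult nn_integral_p_growth[OF t] q)
  finally have "ennreal \<delta> * (\<integral>\<^sup>+l. I l \<partial>law) + ennreal \<delta> * (\<integral>\<^sup>+l. R l \<partial>law) = ennreal \<delta> * (\<integral>\<^sup>+l. I l \<partial>law) + ennreal (growth t - 1)"
    unfolding J by (simp add: distrib_left add.commute)
  moreover have "ennreal \<delta> * (\<integral>\<^sup>+l. I l \<partial>law) < \<infinity>" using Ifin by (simp add: ennreal_mult_less_top)
  ultimately show ?thesis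
    unfolding R_def by (auto simp: ennreal_add_left_cancel)
qed

lemma nn_integral_hazard:
  assumes law: "prob_space law" "sets law = sets borel" "AE l in law. 0 < l"
    and mean: "(\<integral>\<^sup>+l. ennreal l \<partial>law) = 1"
    and renewal: "\<And>u. 0 \<le> u \<Longrightarrow> ennreal ((1 - p u) * growth u) = (\<integral>\<^sup>+l\<in>{..u}. ennreal (growth (u - l)) \<partial>law)"
    and subcritical: "\<delta> < 1"
  shows "(\<integral>\<^sup>+u\<in>{0..}. ennreal (p u) \<partial>lborel) = ennreal (- ln (1 - \<delta>) / \<delta>)"
proof -
  interpret law: prob_space law by fact
  note law(2)[measurable_cong]
  have excess: "ennreal (growth t - 1) = ennreal \<delta> * (\<integral>\<^sup>+l. (\<integral>\<^sup>+v\<in>{0..t} \<inter> {t - l<..}. ennreal (growth v) \<partial>lborel) \<partial>law)"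
    if "0 \<le> t" for t
    by (rule growth_excess[OF law _ that]) (rule renewal)
  \<comment> \<open>The window has length at most \<open>l\<close> and \<open>growth\<close> is at
    most \<open>growth t\<close> on it, so the mean life 1 gives
    \<open>growth t - 1 \<le> \<delta> * growth t\<close>.\<close>
  have upper: "growth t \<le> 1 / (1 - \<delta>)" if t: "0 \<le> t" for t
  proof -
    have "(\<integral>\<^sup>+l. (\<integral>\<^sup>+v\<in>{0..t} \<inter> {t - l<..}. ennreal (growth v) \<partial>lborel) \<partial>law)
      \<le> (\<integral>\<^sup>+l. ennreal (growth t) * ennreal l \<partial>law)"
    proof (rule nn_integral_mono_AE, rule eventually_mono[OF law(3)])
      fix l :: real assume l: "0 < l"
      have "(\<integral>\<^sup>+v\<in>{0..t} \<inter> {t - l<..}. ennreal (growth v) \<partial>lborel) \<le> (\<integral>\<^sup>+v. ennreal (growth t) * indicator {t - l..t} v \<partial>lborel)"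
        by (intro nn_integral_mono) (auto split: split_indicator intro!: ennreal_leI monoD[OF mono_growth])
      also have "\<dots> = ennreal (growth t) * ennreal l"
        using l by (simp add: nn_integral_cmult)
      finally show "(\<integral>\<^sup>+v\<in>{0..t} \<inter> {t - l<..}. ennreal (growth v) \<partial>lborel) \<le> ennreal (growth t) * ennreal l" .
    qed
    also have "\<dots> = ennreal (growth t)"
      by (subst nn_integral_cmult) (auto simp: mean)
    finally have "ennreal (growth t - 1) \<le> ennreal \<delta> * ennreal (growth t)"
      using excess[OF t] by (simp add: mult_left_mono)
    then have "growth t - 1 \<le> \<delta> * growth t"
      using rate_pos growth_pos[of t] by (simp add: ennreal_mult'[symmetric] less_imp_le)
    then show ?thesis using subcritical by (simp add: field_simps)
  qed
  have inc: "incseq (\<lambda>n. growth (real n))"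
    by (intro incseq_SucI monoD[OF mono_growth]) simp
  then obtain g where g: "(\<lambda>n. growth (real n)) \<longlonglongrightarrow> g" "\<And>n. growth (real n) \<le> g"
    using incseq_convergent[OF inc, of "1 / (1 - \<delta>)"] upper by auto
  have g_bound: "growth t \<le> g" for t
  proof -
    have "growth t \<le> growth (real (nat \<lceil>t\<rceil>))" using mono_growth by (rule monoD) linarith
    then show ?thesis using g(2) order_trans by blast
  qed
  \<comment> \<open>At time \<open>a + real n\<close> the window is shortened to length
    \<open>min l (real n)\<close>, which keeps it to the right of \<open>a\<close>, where
    \<open>growth\<close> is at least \<open>growth a\<close>. Letting \<open>n\<close> grow
    restores the mean 1 by monotone convergence.\<close>
  have lower: "\<delta> * growth a \<le> g - 1" if a: "0 \<le> a" for a
  proof -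
    have "ennreal (\<delta> * growth a) * (\<integral>\<^sup>+l. ennreal (min l (real n)) \<partial>law) \<le> ennreal (g - 1)" for n
    proof -
      have "ennreal (growth a) * (\<integral>\<^sup>+l. ennreal (min l (real n)) \<partial>law) = (\<integral>\<^sup>+l. ennreal (growth a) * ennreal (min l (real n)) \<partial>law)"
        by (rule nn_integral_cmult[symmetric]) simp
      also have "\<dots> \<le> (\<integral>\<^sup>+l. (\<integral>\<^sup>+v\<in>{0..a + real n} \<inter> {a + real n - l<..}. ennreal (growth v) \<partial>lborel) \<partial>law)"
      proof (rule nn_integral_mono_AE, rule eventually_mono[OF law(3)])
        fix l :: real assume l: "0 < l"
        have "ennreal (growth a) * ennreal (min l (real n)) = (\<integral>\<^sup>+v. ennreal (growth a) * indicator {a + real n - min l (real n)<..a + real n} v \<partial>lborel)"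
          using l by (simp add: nn_integral_cmult)
        also have "\<dots> \<le> (\<integral>\<^sup>+v\<in>{0..a + real n} \<inter> {a + real n - l<..}. ennreal (growth v) \<partial>lborel)"
          using a by (intro nn_integral_mono) (auto split: split_indicator intro!: ennreal_leI monoD[OF mono_growth])
        finally show "ennreal (growth a) * ennreal (min l (real n)) \<le> (\<integral>\<^sup>+v\<in>{0..a + real n} \<inter> {a + real n - l<..}. ennreal (growth v) \<partial>lborel)" .
      qed
      finally have "ennreal \<delta> * (ennreal (growth a) * (\<integral>\<^sup>+l. ennreal (min l (real n)) \<partial>law)) \<le> ennreal (growth (a + real n) - 1)"
        using excess[of "a + real n"] a by (simp add: mult_left_mono)
      also have "\<dots> \<le> ennreal (g - 1)" using g_bound by (intro ennreal_leI) auto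
      finally show ?thesis using rate_pos by (simp add: ennreal_mult' mult.assoc)
    qed
    then have "(SUP n. ennreal (\<delta> * growth a) * (\<integral>\<^sup>+l. ennreal (min l (real n)) \<partial>law)) \<le> ennreal (g - 1)"
      by (intro SUP_least) auto
    also have "(SUP n. ennreal (\<delta> * growth a) * (\<integral>\<^sup>+l. ennreal (min l (real n)) \<partial>law))
        = ennreal (\<delta> * growth a) * (\<integral>\<^sup>+l. (SUP n. ennreal (min l (real n))) \<partial>law)"
      by (subst nn_integral_monotone_convergence_SUP)
        (auto simp: SUP_mult_left_ennreal incseq_def le_fun_def intro!: ennreal_leI min.mono)
    also have "(\<integral>\<^sup>+l. (SUP n. ennreal (min l (real n))) \<partial>law) = (\<integral>\<^sup>+l. ennreal l \<partial>law)"
    proof (rule nn_integral_cong)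
      fix l :: real
      obtain n where "l \<le> real n" using real_arch_simple by blast
      then show "(SUP n. ennreal (min l (real n))) = ennreal l"
        by (intro antisym SUP_least SUP_upper2[of n]) (auto intro!: ennreal_leI)
    qed
    finally have "ennreal (\<delta> * growth a) \<le> ennreal (g - 1)" by (simp add: mean)
    moreover have "0 \<le> g - 1" using g_bound[of 0] by (simp add: growth_0)
    ultimately show ?thesis by simp
  qed
  have "\<delta> * g \<le> g - 1"
    using g(1) lower by (intro LIMSEQ_le_const2[OF tendsto_mult_left[OF g(1)]]) auto
  moreover have "g \<le> 1 / (1 - \<delta>)"
    using g(1) upper by (intro LIMSEQ_le_const2[OF g(1)]) auto
  ultimately have g_eq: "g = 1 / (1 - \<delta>)" using subcritical by (simp add: field_simps)
  have "(\<lambda>n. ln (growth (real n)) / \<delta>) \<longlonglongrightarrow> ln g / \<delta>"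
    using g_eq subcritical rate_pos by (intro tendsto_intros g) auto
  moreover have "ln (growth t) / \<delta> = integral {0..t} p" for t
    using rate_pos by (simp add: growth_def)
  ultimately have 1: "(\<lambda>n. \<integral>\<^sup>+v\<in>{0..real n}. ennreal (p v) \<partial>lborel) \<longlonglongrightarrow> ennreal (ln g / \<delta>)"
    unfolding nn_integral_p by (simp add: tendsto_ennrealI)
  have "incseq (\<lambda>n v. ennreal (p v) * indicator {0..real n} v)"
    by (auto simp: incseq_def le_fun_def split: split_indicator)
  then have "(\<lambda>n. \<integral>\<^sup>+v\<in>{0..real n}. ennreal (p v) \<partial>lborel) \<longlonglongrightarrow> (\<integral>\<^sup>+v. (SUP n. ennreal (p v) * indicator {0..real n} v) \<partial>lborel)"
    by (subst nn_integral_monotone_convergence_SUP) (auto intro!: LIMSEQ_SUP incseq_nn_integral)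
  also have "(\<integral>\<^sup>+v. (SUP n. ennreal (p v) * indicator {0..real n} v) \<partial>lborel) = (\<integral>\<^sup>+v\<in>{0..}. ennreal (p v) \<partial>lborel)"
  proof (rule nn_integral_cong)
    fix v :: real
    obtain n where "v \<le> real n" using real_arch_simple by blast
    then show "(SUP n. ennreal (p v) * indicator {0..real n} v) = ennreal (p v) * indicator {0..} v"
      by (intro antisym SUP_least SUP_upper2[of n]) (auto split: split_indicator)
  qed
  finally have "(\<integral>\<^sup>+v\<in>{0..}. ennreal (p v) \<partial>lborel) = ennreal (ln g / \<delta>)"
    using 1 by (rule LIMSEQ_unique)
  then show ?thesis using subcritical by (simp add: g_eq ln_div)
qed

end

section \<open>The law of the tree and the renewal equation\<close>

definition birth_law :: "real \<Rightarrow> (nat \<Rightarrow> real) measure" where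
  "birth_law r = distr (waiting_times r) (\<Pi>\<^sub>M n\<in>UNIV. borel) (\<lambda>w n. sum w {..n})"

lemma sets_waiting_times [measurable_cong]: "sets (waiting_times r) = sets (\<Pi>\<^sub>M n\<in>UNIV. borel)"
  by (intro sets_PiM_cong) auto

lemma partial_sums_measurable [measurable]:
  "(\<lambda>w n. sum w {..n}) \<in> waiting_times r \<rightarrow>\<^sub>M (\<Pi>\<^sub>M n\<in>(UNIV :: nat set). (borel :: real measure))"
  by (intro measurable_PiM_single') (auto simp: space_PiM PiE_def)

lemma sets_birth_law [measurable_cong, simp]: "sets (birth_law r) = sets (\<Pi>\<^sub>M n\<in>UNIV. borel)"
  by (simp add: birth_law_def)

lemma prob_space_waiting_times: "0 < r \<Longrightarrow> prob_space (waiting_times r)"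
  by (intro prob_space_PiM prob_space_exponential_density)

lemma prob_space_birth_law: "0 < r \<Longrightarrow> prob_space (birth_law r)"
  unfolding birth_law_def by (intro prob_space.prob_space_distr prob_space_waiting_times) measurable

locale splitting_law =
  fixes \<delta> :: real and law :: "real measure"
  assumes delta_pos: "0 < \<delta>" and prob_law: "prob_space law" and sets_law [measurable_cong, simp]: "sets law = sets borel"
begin

abbreviation node_law :: "node measure" where
  "node_law \<equiv> law \<Otimes>\<^sub>M birth_law \<delta>"

abbreviation tree_law :: "(nat list \<Rightarrow> node) measure" where
  "tree_law \<equiv> \<Pi>\<^sub>M x\<in>UNIV. node_law"

lemma sets_node_law [measurable_cong]: "sets node_law = sets node_space"
  by (intro sets_pair_measure_cong) auto

lemma sets_tree_law [measurable_cong]: "sets tree_law = sets tree_space"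
  by (intro sets_PiM_cong sets_node_law) auto

lemma space_tree_law [simp]: "space tree_law = UNIV"
  using sets_eq_imp_space_eq[OF sets_tree_law] by (auto simp: space_PiM space_pair_measure)

lemma prob_node_law: "prob_space node_law"
proof -
  interpret law: prob_space law by (rule prob_law)
  interpret B: prob_space "birth_law \<delta>" using delta_pos by (rule prob_space_birth_law)
  interpret pair_prob_space law "birth_law \<delta>" ..
  show ?thesis by (rule P.prob_space_axioms)
qed

sublocale tree: prob_space tree_law
  by (intro prob_space_PiM prob_node_law)

lemma nn_integral_node_law:
  assumes [measurable]: "f \<in> borel_measurable node_space"
  shows "(\<integral>\<^sup>+z. f z \<partial>node_law) = (\<integral>\<^sup>+l. \<integral>\<^sup>+w. f (l, \<lambda>n. sum w {..n}) \<partial>waiting_times \<delta> \<partial>law)"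
proof -
  interpret B: prob_space "birth_law \<delta>" using delta_pos by (rule prob_space_birth_law)
  have "(\<integral>\<^sup>+z. f z \<partial>node_law) = (\<integral>\<^sup>+l. \<integral>\<^sup>+s. f (l, s) \<partial>birth_law \<delta> \<partial>law)"
    by (rule B.nn_integral_fst[symmetric]) measurable
  then show ?thesis
    unfolding birth_law_def by (subst (asm) nn_integral_distr) auto
qed

definition survival :: "real \<Rightarrow> real" where
  "survival u = measure tree_law {Z. alive life birth u Z \<noteq> {}}"

lemma alive_empty_sets [measurable]: "{Z. alive life birth u Z = {}} \<in> sets tree_law"
proof -
  have "Measurable.pred tree_space (\<lambda>Z. alive life birth u Z = {})" by measurable
  then show ?thesis by (simp add: pred_def sets_tree_law space_PiM space_pair_measure)
qed

lemma alive_nonempty_sets [measurable]: "{Z. alive life birth u Z \<noteq> {}} \<in> sets tree_law"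
proof -
  have "{Z. alive life birth u Z \<noteq> {}} = space tree_law - {Z. alive life birth u Z = {}}" by auto
  then show ?thesis by (metis alive_empty_sets sets.compl_sets)
qed

lemma emeasure_alive_nonempty: "emeasure tree_law {Z. alive life birth u Z \<noteq> {}} = ennreal (survival u)"
  unfolding survival_def by (rule tree.emeasure_eq_measure)

lemma emeasure_alive_empty: "emeasure tree_law {Z. alive life birth u Z = {}} = ennreal (1 - survival u)"
proof -
  have "{Z. alive life birth u Z \<noteq> {}} = space tree_law - {Z. alive life birth u Z = {}}" by auto
  then have "survival u = 1 - measure tree_law {Z. alive life birth u Z = {}}"
    unfolding survival_def by (metis alive_empty_sets tree.prob_compl)
  then show ?thesis by (simp add: tree.emeasure_eq_measure)
qed

lemma survival_borel: "survival \<in> borel_measurable borel"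
proof -
  have "(\<lambda>u. enn2real (\<integral>\<^sup>+Z. indicator {(u, Z). alive life birth u Z \<noteq> {}} (u, Z) \<partial>tree_law)) \<in> borel_measurable borel"
    by measurable
  also have "(\<lambda>u. enn2real (\<integral>\<^sup>+Z. indicator {(u, Z). alive life birth u Z \<noteq> {}} (u, Z) \<partial>tree_law)) = survival"
  proof
    fix u
    have "(\<integral>\<^sup>+Z. indicator {(u, Z). alive life birth u Z \<noteq> {}} (u, Z) \<partial>tree_law)
        = (\<integral>\<^sup>+Z. indicator {Z. alive life birth u Z \<noteq> {}} Z \<partial>tree_law)"
      by (intro nn_integral_cong) (simp add: indicator_def)
    also have "\<dots> = ennreal (survival u)"
      unfolding emeasure_alive_nonempty[symmetric] by (rule nn_integral_indicator[OF alive_nonempty_sets])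
    finally show "enn2real (\<integral>\<^sup>+Z. indicator {(u, Z). alive life birth u Z \<noteq> {}} (u, Z) \<partial>tree_law) = survival u"
      by (simp add: survival_def)
  qed
  finally show ?thesis .
qed

sublocale hazard \<delta> survival
  using delta_pos survival_borel by unfold_locales (auto simp: survival_def)

text \<open>Only finitely many subtrees are considered, so that independence turns into a finite product.\<close>
definition extinct_upto :: "nat \<Rightarrow> real \<Rightarrow> (nat list \<Rightarrow> node) set" where
  "extinct_upto n u = {Z. life [] Z \<le> u \<and>
    (\<forall>i<n. birth [] i Z < life [] Z \<longrightarrow> alive life birth (u - birth [] i Z) (subtree i Z) = {})}"

lemma subtree_measurable [measurable]: "subtree n \<in> tree_space \<rightarrow>\<^sub>M tree_space"
  unfolding subtree_def[abs_def]
  by (intro measurable_PiM_single' measurable_component_singleton) (auto simp: space_PiM)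

text \<open>Given the root's life-length \<open>l\<close> and its births, the first \<open>n\<close>
  subtrees are independent copies of the tree: a child born at \<open>s < l\<close> has an extinct
  subtree with probability \<open>1 - survival (u - s)\<close>, and a later point imposes no
  condition. These are the factors \<open>weight\<close>.\<close>

lemma emeasure_extinct_upto:
  "emeasure tree_law (extinct_upto n u) =
    (\<integral>\<^sup>+l\<in>{..u}. (\<integral>\<^sup>+w. ennreal (\<Prod>i<n. weight u l (sum w {..i})) \<partial>waiting_times \<delta>) \<partial>law)"
  and extinct_upto_sets: "extinct_upto n u \<in> sets tree_law"
proof -
  let ?D = "\<Pi>\<^sub>M n\<in>(UNIV :: nat set). tree_law"
  interpret D: product_prob_space "\<lambda>_. tree_law" "UNIV :: nat set" ..
  define f :: "node \<times> (nat \<Rightarrow> nat list \<Rightarrow> node) \<Rightarrow> ennreal" where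
    "f = (\<lambda>(z, Y). indicator {p. fst (fst p) \<le> u \<and>
        (\<forall>i<n. snd (fst p) i < fst (fst p) \<longrightarrow> alive life birth (u - snd (fst p) i) (snd p i) = {})} (z, Y))"
  have [measurable]: "Measurable.pred (node_space \<Otimes>\<^sub>M (\<Pi>\<^sub>M n\<in>UNIV. tree_space))
      (\<lambda>p. alive life birth (u - snd (fst p) i) (snd p i) = {})" for i
  proof -
    have "(\<lambda>p. (u - snd (fst p) i, snd p i)) \<in> node_space \<Otimes>\<^sub>M (\<Pi>\<^sub>M n\<in>UNIV. tree_space) \<rightarrow>\<^sub>M borel \<Otimes>\<^sub>M tree_space"
      by measurable
    from measurable_compose[OF this alive_empty_measurable] show ?thesis by simp
  qed
  have f [measurable]: "f \<in> borel_measurable (node_law \<Otimes>\<^sub>M ?D)"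
    unfolding f_def by measurable
  show sets: "extinct_upto n u \<in> sets tree_law"
  proof -
    have "Measurable.pred tree_space (\<lambda>Z. alive life birth (u - birth [] i Z) (subtree i Z) = {})" for i
    proof -
      have "(\<lambda>Z. (u - birth [] i Z, subtree i Z)) \<in> tree_space \<rightarrow>\<^sub>M borel \<Otimes>\<^sub>M tree_space"
        by measurable
      from measurable_compose[OF this alive_empty_measurable] show ?thesis by simp
    qed
    note this [measurable]
    have "Measurable.pred tree_space (\<lambda>Z. life [] Z \<le> u \<and>
        (\<forall>i<n. birth [] i Z < life [] Z \<longrightarrow> alive life birth (u - birth [] i Z) (subtree i Z) = {}))"
      by measurable
    then show ?thesis
      unfolding extinct_upto_def by (simp add: pred_def sets_tree_law space_PiM space_pair_measure)
  qed
  have "emeasure tree_law (extinct_upto n u) = (\<integral>\<^sup>+Z. f (Z [], \<lambda>n. subtree n Z) \<partial>tree_law)"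
    by (subst nn_integral_indicator[OF sets, symmetric], intro nn_integral_cong)
      (simp add: f_def extinct_upto_def indicator_def)
  also have "\<dots> = (\<integral>\<^sup>+z. \<integral>\<^sup>+Y. f (z, Y) \<partial>?D \<partial>node_law)"
    by (rule nn_integral_PiM_branching[OF prob_node_law f])
  also have "\<dots> = (\<integral>\<^sup>+z. indicator {..u} (fst z) * ennreal (\<Prod>i<n. weight u (fst z) (snd z i)) \<partial>node_law)"
  proof (rule nn_integral_cong)
    fix z :: node
    let ?X = "\<lambda>i. {Z. snd z i < fst z \<longrightarrow> alive life birth (u - snd z i) Z = {}}"
    have X: "?X i \<in> sets tree_law" for i
      by (cases "snd z i < fst z") (auto intro: alive_empty_sets simp: sets.top[of tree_law, simplified])
    have "(\<integral>\<^sup>+Y. f (z, Y) \<partial>?D) = (\<integral>\<^sup>+Y. indicator {..u} (fst z) * indicator {Y \<in> space ?D. \<forall>i\<in>{..<n}. Y i \<in> ?X i} Y \<partial>?D)"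
      by (intro nn_integral_cong) (auto simp: f_def split: split_indicator)
    also have "\<dots> = indicator {..u} (fst z) * emeasure ?D {Y \<in> space ?D. \<forall>i\<in>{..<n}. Y i \<in> ?X i}"
      using X by (subst nn_integral_cmult_indicator) auto
    also have "emeasure ?D {Y \<in> space ?D. \<forall>i\<in>{..<n}. Y i \<in> ?X i} = (\<Prod>i<n. emeasure tree_law (?X i))"
      by (rule D.emeasure_PiM_Collect) (auto intro: X)
    also have "\<dots> = (\<Prod>i<n. ennreal (weight u (fst z) (snd z i)))"
      by (intro prod.cong) (auto simp: weight_def emeasure_alive_empty tree.emeasure_space_1[simplified])
    also have "\<dots> = ennreal (\<Prod>i<n. weight u (fst z) (snd z i))"
      by (rule prod_ennreal) (simp add: weight_bounds)
    finally show "(\<integral>\<^sup>+Y. f (z, Y) \<partial>?D) = indicator {..u} (fst z) * ennreal (\<Prod>i<n. weight u (fst z) (snd z i))" .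
  qed
  also have "\<dots> = (\<integral>\<^sup>+l. \<integral>\<^sup>+w. indicator {..u} l * ennreal (\<Prod>i<n. weight u l (sum w {..i})) \<partial>waiting_times \<delta> \<partial>law)"
    by (subst nn_integral_node_law) auto
  also have "\<dots> = (\<integral>\<^sup>+l\<in>{..u}. (\<integral>\<^sup>+w. ennreal (\<Prod>i<n. weight u l (sum w {..i})) \<partial>waiting_times \<delta>) \<partial>law)"
    by (intro nn_integral_cong) (subst nn_integral_cmult, auto simp: mult.commute)
  finally show "emeasure tree_law (extinct_upto n u) =
    (\<integral>\<^sup>+l\<in>{..u}. (\<integral>\<^sup>+w. ennreal (\<Prod>i<n. weight u l (sum w {..i})) \<partial>waiting_times \<delta>) \<partial>law)" .
qed

lemma alive_empty_eq_INT:
  assumes "0 \<le> u"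
  shows "{Z. alive life birth u Z = {}} = (\<Inter>n. extinct_upto n u)"
proof -
  have *: "(P \<and> (\<forall>i. Q i)) \<longleftrightarrow> (\<forall>n. P \<and> (\<forall>i<n. Q i))" for P and Q :: "nat \<Rightarrow> bool"
    by (meson lessI)
  show ?thesis
  proof (rule set_eqI)
    fix Z
    show "Z \<in> {Z. alive life birth u Z = {}} \<longleftrightarrow> Z \<in> (\<Inter>n. extinct_upto n u)"
      unfolding extinct_upto_def INT_iff mem_Collect_eq ball_UNIV alive_eq_empty_iff[OF assms, of Z]
      by (rule *)
  qed
qed

text \<open>By \<open>expected_arrivals\<close> the probabilities have the finite sum
  \<open>ennreal (\<delta> * u)\<close>.\<close>

lemma emeasure_arrivals_tendsto_0:
  "(\<lambda>n. emeasure (waiting_times \<delta>) {w \<in> space (waiting_times \<delta>). sum w {..n} < u}) \<longlonglongrightarrow> 0"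
proof -
  interpret W: prob_space "waiting_times \<delta>" using delta_pos by (rule prob_space_waiting_times)
  have "summable (\<lambda>n. measure (waiting_times \<delta>) {w \<in> space (waiting_times \<delta>). sum w {..n} < u})"
  proof (rule summable_suminf_not_top)
    show "(\<Sum>n. ennreal (measure (waiting_times \<delta>) {w \<in> space (waiting_times \<delta>). sum w {..n} < u})) \<noteq> \<top>"
      unfolding W.emeasure_eq_measure[symmetric] expected_arrivals[OF delta_pos] by simp
  qed simp
  from tendsto_ennrealI[OF summable_LIMSEQ_zero[OF this]] show ?thesis
    unfolding W.emeasure_eq_measure by simp
qed

text \<open>Extinction is the decreasing limit of \<open>extinct_upto n u\<close>. The probabilities
  lie between \<open>c\<close> and \<open>c\<close> plus a vanishing error, so
  \<open>1 - survival u\<close> is \<open>c\<close>, and multiplying by \<open>growth u\<close>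
  clears the denominator of \<open>tail_value\<close>.\<close>

lemma renewal:
  assumes u: "0 \<le> u" and pos: "AE l in law. 0 < l"
  shows "ennreal ((1 - survival u) * growth u) = (\<integral>\<^sup>+l\<in>{..u}. ennreal (growth (u - l)) \<partial>law)"
proof -
  interpret law: prob_space law by (rule prob_law)
  define c where "c = (\<integral>\<^sup>+l\<in>{..u}. ennreal (tail_value u l 0) \<partial>law)"
  let ?W = "waiting_times \<delta>"
  have lim: "(\<lambda>n. emeasure tree_law (extinct_upto n u)) \<longlonglongrightarrow> emeasure tree_law (\<Inter>n. extinct_upto n u)"
  proof (rule Lim_emeasure_decseq)
    show "decseq (\<lambda>n. extinct_upto n u)" by (auto simp: decseq_def extinct_upto_def)
  qed (auto simp: extinct_upto_sets)
  have lo: "c \<le> emeasure tree_law (extinct_upto n u)" for n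
    unfolding c_def emeasure_extinct_upto
    by (intro nn_integral_mono) (auto split: split_indicator intro: tail_value_le_expected_prod_weight)
  \<comment> \<open>The error is taken with \<open>u\<close> in place of \<open>l\<close>, so that
    it is constant in \<open>l\<close> and equals its integral over the probability measure
    \<open>law\<close>.\<close>
  have hi: "emeasure tree_law (extinct_upto (Suc n) u) \<le> c + emeasure ?W {w \<in> space ?W. sum w {..n} < u}" for n
  proof -
    have "emeasure tree_law (extinct_upto (Suc n) u) \<le>
      (\<integral>\<^sup>+l. ennreal (tail_value u l 0) * indicator {..u} l + emeasure ?W {w \<in> space ?W. sum w {..n} < u} \<partial>law)"
      unfolding emeasure_extinct_upto
    proof (intro nn_integral_mono)
      fix l
      show "(\<integral>\<^sup>+w. ennreal (\<Prod>i<Suc n. weight u l (sum w {..i})) \<partial>?W) * indicator {..u} l \<le>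
        ennreal (tail_value u l 0) * indicator {..u} l + emeasure ?W {w \<in> space ?W. sum w {..n} < u}"
      proof (cases "l \<le> u")
        case True
        have "(\<integral>\<^sup>+w. ennreal (\<Prod>i<Suc n. weight u l (sum w {..i})) \<partial>?W)
          \<le> ennreal (tail_value u l 0) + emeasure ?W {w \<in> space ?W. sum w {..n} < l}"
          using True by (rule expected_prod_weight_le)
        also have "\<dots> \<le> ennreal (tail_value u l 0) + emeasure ?W {w \<in> space ?W. sum w {..n} < u}"
          using True by (intro add_left_mono emeasure_mono) auto
        finally show ?thesis using True by simp
      qed simp
    qed
    also have "\<dots> = c + emeasure ?W {w \<in> space ?W. sum w {..n} < u}"
      unfolding c_def by (subst nn_integral_add) (auto simp: law.emeasure_space_1)
    finally show ?thesis .
  qed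
  have up: "(\<lambda>n. c + emeasure ?W {w \<in> space ?W. sum w {..n} < u}) \<longlonglongrightarrow> c"
    using tendsto_add[OF tendsto_const[of c] emeasure_arrivals_tendsto_0[of u]] by simp
  have "(\<lambda>n. emeasure tree_law (extinct_upto (Suc n) u)) \<longlonglongrightarrow> c"
    by (rule tendsto_sandwich[OF _ _ tendsto_const up]) (use lo hi in \<open>blast intro: always_eventually\<close>)+
  then have "emeasure tree_law (\<Inter>n. extinct_upto n u) = c"
    using LIMSEQ_Suc[OF lim] LIMSEQ_unique by blast
  then have "ennreal (1 - survival u) = c"
    using emeasure_alive_empty[of u] alive_empty_eq_INT[OF u] by simp
  then have "ennreal ((1 - survival u) * growth u) = (\<integral>\<^sup>+l\<in>{..u}. ennreal (tail_value u l 0) \<partial>law) * ennreal (growth u)"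
    using growth_pos[of u] by (simp add: ennreal_mult'' less_imp_le c_def)
  also have "\<dots> = (\<integral>\<^sup>+l. ennreal (tail_value u l 0) * indicator {..u} l * ennreal (growth u) \<partial>law)"
    by (rule nn_integral_multc[symmetric]) measurable
  \<comment> \<open>Positivity of life-lengths enters here: for \<open>l \<le> 0\<close>,
    \<open>tail_value u l 0\<close> has its default value 1 instead of the quotient.\<close>
  also have "\<dots> = (\<integral>\<^sup>+l\<in>{..u}. ennreal (growth (u - l)) \<partial>law)"
    using growth_pos[of u]
    by (intro nn_integral_cong_AE, use pos in eventually_elim)
      (auto simp: tail_value_def ennreal_mult''[symmetric] less_imp_le split: split_indicator)
  finally show ?thesis .
qed

end

section \<open>Total progeny\<close>

context splitting_law begin

definition birth_prob :: "nat \<Rightarrow> ennreal" where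
  "birth_prob n = emeasure node_law {z. snd z n < fst z}"

lemma birth_event_sets [measurable]: "{z. snd z n < fst z} \<in> sets node_law"
proof -
  have "Measurable.pred node_space (\<lambda>z. snd z n < fst z)" by measurable
  then show ?thesis by (simp add: pred_def sets_node_law space_pair_measure space_PiM)
qed

lemma born_sets [measurable]: "{Z. born life birth x Z} \<in> sets tree_law"
proof -
  have "Measurable.pred tree_space (\<lambda>Z. born life birth x Z)" by measurable
  then show ?thesis by (simp add: pred_def sets_tree_law space_pair_measure space_PiM)
qed

text \<open>Splitting a label at its last entry peels off the root, whose node is independent of the
  child's subtree, and that subtree has the law of the whole tree.\<close>

lemma emeasure_born_subtree:
  "emeasure tree_law {Z. born life birth (x @ [n]) Z} = birth_prob n * emeasure tree_law {Z. born life birth x Z}"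
proof -
  let ?D = "\<Pi>\<^sub>M n\<in>(UNIV :: nat set). tree_law"
  define f :: "node \<times> (nat \<Rightarrow> nat list \<Rightarrow> node) \<Rightarrow> ennreal" where
    "f p = indicator {z. snd z n < fst z} (fst p) * indicator {Z. born life birth x Z} (snd p n)" for p
  have f: "f \<in> borel_measurable (node_law \<Otimes>\<^sub>M ?D)"
    unfolding f_def by measurable
  have "emeasure tree_law {Z. born life birth (x @ [n]) Z} = (\<integral>\<^sup>+Z. f (Z [], \<lambda>n. subtree n Z) \<partial>tree_law)"
    by (subst nn_integral_indicator[OF born_sets, symmetric], intro nn_integral_cong)
      (simp add: f_def born_subtree indicator_def)
  also have "\<dots> = (\<integral>\<^sup>+z. \<integral>\<^sup>+Y. f (z, Y) \<partial>?D \<partial>node_law)"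
    by (rule nn_integral_PiM_branching[OF prob_node_law f])
  also have "\<dots> = (\<integral>\<^sup>+z. indicator {z. snd z n < fst z} z * emeasure tree_law {Z. born life birth x Z} \<partial>node_law)"
  proof (rule nn_integral_cong)
    fix z :: node
    have "(\<integral>\<^sup>+Y. f (z, Y) \<partial>?D) = indicator {z. snd z n < fst z} z * (\<integral>\<^sup>+Y. indicator {Z. born life birth x Z} (Y n) \<partial>?D)"
      unfolding f_def by (simp, rule nn_integral_cmult) measurable
    also have "(\<integral>\<^sup>+Y. indicator {Z. born life birth x Z} (Y n) \<partial>?D) = (\<integral>\<^sup>+Z. indicator {Z. born life birth x Z} Z \<partial>distr ?D tree_law (\<lambda>Y. Y n))"
      by (subst nn_integral_distr) auto
    also have "\<dots> = emeasure tree_law {Z. born life birth x Z}"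
      by (subst distr_PiM_component) (auto simp: tree.prob_space_axioms)
    finally show "(\<integral>\<^sup>+Y. f (z, Y) \<partial>?D) = indicator {z. snd z n < fst z} z * emeasure tree_law {Z. born life birth x Z}" .
  qed
  also have "\<dots> = birth_prob n * emeasure tree_law {Z. born life birth x Z}"
    unfolding birth_prob_def nn_integral_indicator[OF birth_event_sets, symmetric]
    by (rule nn_integral_multc) measurable
  finally show ?thesis .
qed

text \<open>The sum is the mean number of children of the root; for a fixed life-length
  \<open>l\<close> it is \<open>\<delta> * l\<close> by \<open>expected_arrivals\<close>.\<close>

lemma suminf_birth_prob: "(\<Sum>n. birth_prob n) = ennreal \<delta> * (\<integral>\<^sup>+l. ennreal l \<partial>law)"
proof -
  have "birth_prob n = (\<integral>\<^sup>+l. emeasure (waiting_times \<delta>) {w \<in> space (waiting_times \<delta>). sum w {..n} < l} \<partial>law)" for n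
  proof -
    have "birth_prob n = (\<integral>\<^sup>+z. indicator {z. snd z n < fst z} z \<partial>node_law)"
      unfolding birth_prob_def by (rule nn_integral_indicator[symmetric, OF birth_event_sets])
    also have "\<dots> = (\<integral>\<^sup>+l. \<integral>\<^sup>+w. indicator {z. snd z n < fst z} (l, \<lambda>n. sum w {..n}) \<partial>waiting_times \<delta> \<partial>law)"
      by (rule nn_integral_node_law) measurable
    also have "\<dots> = (\<integral>\<^sup>+l. \<integral>\<^sup>+w. indicator {w \<in> space (waiting_times \<delta>). sum w {..n} < l} w \<partial>waiting_times \<delta> \<partial>law)"
      by (intro nn_integral_cong) (simp add: indicator_def)
    also have "\<dots> = (\<integral>\<^sup>+l. emeasure (waiting_times \<delta>) {w \<in> space (waiting_times \<delta>). sum w {..n} < l} \<partial>law)"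
      by (intro nn_integral_cong nn_integral_indicator) measurable
    finally show ?thesis .
  qed
  then have "(\<Sum>n. birth_prob n) = (\<Sum>n. \<integral>\<^sup>+l. emeasure (waiting_times \<delta>) {w \<in> space (waiting_times \<delta>). sum w {..n} < l} \<partial>law)"
    by simp
  also have "\<dots> = (\<integral>\<^sup>+l. (\<Sum>n. emeasure (waiting_times \<delta>) {w \<in> space (waiting_times \<delta>). sum w {..n} < l}) \<partial>law)"
  proof (rule nn_integral_suminf[symmetric])
    interpret W: prob_space "waiting_times \<delta>" using delta_pos by (rule prob_space_waiting_times)
    show "(\<lambda>l. emeasure (waiting_times \<delta>) {w \<in> space (waiting_times \<delta>). sum w {..n} < l}) \<in> borel_measurable law" for n
      by measurable
  qed
  also have "\<dots> = (\<integral>\<^sup>+l. ennreal (\<delta> * l) \<partial>law)"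
    by (simp only: expected_arrivals[OF delta_pos])
  also have "\<dots> = (\<integral>\<^sup>+l. ennreal \<delta> * ennreal l \<partial>law)"
    using delta_pos by (simp add: ennreal_mult')
  also have "\<dots> = ennreal \<delta> * (\<integral>\<^sup>+l. ennreal l \<partial>law)"
    by (rule nn_integral_cmult) simp
  finally show ?thesis .
qed

text \<open>Generation k + 1 is indexed by a child \<open>n\<close> of the root and a label
  \<open>x\<close> of generation k in its subtree. The probabilities factor over such pairs, and the
  sum over \<open>n\<close> is the mean offspring number \<delta>.\<close>

lemma expected_generation_size:
  assumes mean: "(\<integral>\<^sup>+l. ennreal l \<partial>law) = 1"
  shows "(\<integral>\<^sup>+x. emeasure tree_law {Z. born life birth x Z} * indicator {x. length x = k} x \<partial>count_space UNIV) = ennreal \<delta> ^ k"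
proof (induction k)
  let ?b = "\<lambda>x. emeasure tree_law {Z. born life birth x Z}"
  case 0
  have "(\<integral>\<^sup>+x. ?b x * indicator {x. length x = 0} x \<partial>count_space UNIV) = (\<integral>\<^sup>+x. ?b x * indicator {[]} x \<partial>count_space UNIV)"
    by (intro nn_integral_cong) (auto split: split_indicator)
  also have "\<dots> = 1"
  proof -
    have "Collect (born life birth []) = (UNIV :: (nat list \<Rightarrow> node) set)" by auto
    then show ?thesis
      using tree.emeasure_space_1 by (subst nn_integral_indicator_singleton) (auto simp: one_ennreal_def[symmetric])
  qed
  finally show ?case by simp
next
  let ?b = "\<lambda>x. emeasure tree_law {Z. born life birth x Z}"
  case (Suc k)
  have bij: "bij_betw (\<lambda>(x, n). x @ [n]) UNIV (UNIV - {[]} :: nat list set)"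
    by (rule bij_betwI[where g="\<lambda>x. (butlast x, last x)"]) auto
  have "(\<integral>\<^sup>+x. ?b x * indicator {x. length x = Suc k} x \<partial>count_space UNIV)
      = (\<integral>\<^sup>+x. ?b x * indicator {x. length x = Suc k} x \<partial>count_space (UNIV - {[]}))"
    by (subst (2) nn_integral_count_space_indicator) (auto intro!: nn_integral_cong split: split_indicator)
  also have "\<dots> = (\<integral>\<^sup>+p. ?b (case p of (x, n) \<Rightarrow> x @ [n]) * indicator {x. length x = Suc k} (case p of (x, n) \<Rightarrow> x @ [n]) \<partial>count_space UNIV)"
    by (rule nn_integral_bij_count_space[OF bij, symmetric])
  also have "\<dots> = (\<integral>\<^sup>+x. \<integral>\<^sup>+n. birth_prob n * (?b x * indicator {x. length x = k} x) \<partial>count_space UNIV \<partial>count_space UNIV)"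
    unfolding nn_integral_fst_count_space[symmetric]
    by (intro nn_integral_cong) (simp add: emeasure_born_subtree indicator_def)
  also have "\<dots> = (\<integral>\<^sup>+x. ennreal \<delta> * (?b x * indicator {x. length x = k} x) \<partial>count_space UNIV)"
    by (simp add: nn_integral_multc nn_integral_count_space_nat suminf_birth_prob mean)
  also have "\<dots> = ennreal \<delta> ^ Suc k"
    by (simp add: nn_integral_cmult Suc.IH)
  finally show ?case .
qed

text \<open>Summed over the generations, the mean total progeny is the geometric series in \<delta>.
  Finiteness rules out the value \<open>\<infinity>\<close> of \<open>population\<close>, which
  counts as alive but matches no finite \<open>K\<close>.\<close>

lemma AE_finite_progeny:
  assumes mean: "(\<integral>\<^sup>+l. ennreal l \<partial>law) = 1" and subcritical: "\<delta> < 1"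
  shows "AE Z in tree_law. finite {x. born life birth x Z}"
proof -
  let ?b = "\<lambda>x. emeasure tree_law {Z. born life birth x Z}"
  have [measurable]: "(\<lambda>Z. \<integral>\<^sup>+x. indicator {Z. born life birth x Z} Z \<partial>count_space UNIV) \<in> borel_measurable tree_law"
  proof (rule sigma_finite_measure.borel_measurable_nn_integral[OF sigma_finite_measure_count_space])
    show "(\<lambda>(Z, x). indicator {Z. born life birth x Z} Z :: ennreal) \<in> borel_measurable (tree_law \<Otimes>\<^sub>M count_space UNIV)"
      unfolding case_prod_beta'
      by (rule measurable_compose_countable[where f="\<lambda>x p. indicator {Z. born life birth x Z} (fst p)" and g=snd]) measurable
  qed
  have "(\<integral>\<^sup>+Z. \<integral>\<^sup>+x. indicator {Z. born life birth x Z} Z \<partial>count_space UNIV \<partial>tree_law)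
      = (\<integral>\<^sup>+x. ?b x \<partial>count_space UNIV)"
    by (subst nn_integral_count_space_nn_integral) auto
  also have "\<dots> = (\<integral>\<^sup>+x. (\<Sum>k. ?b x * indicator {x. length x = k} x) \<partial>count_space UNIV)"
  proof (rule nn_integral_cong)
    fix x :: "nat list"
    have "(\<Sum>k. ?b x * indicator {x. length x = k} x) = (\<Sum>k\<in>{length x}. ?b x * indicator {x. length x = k} x)"
      by (rule suminf_finite) auto
    then show "?b x = (\<Sum>k. ?b x * indicator {x. length x = k} x)" by simp
  qed
  also have "\<dots> = (\<Sum>k. ennreal \<delta> ^ k)"
    by (subst nn_integral_suminf) (auto simp: expected_generation_size[OF mean])
  also have "\<dots> = (\<Sum>k. ennreal (\<delta> ^ k))"
    using delta_pos by (simp add: ennreal_power)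
  also have "\<dots> < \<infinity>"
    using delta_pos subcritical by (subst suminf_ennreal2) (auto simp: summable_geometric)
  finally have "AE Z in tree_law. (\<integral>\<^sup>+x. indicator {Z. born life birth x Z} Z \<partial>count_space UNIV) \<noteq> \<infinity>"
    by (intro nn_integral_PInf_AE) auto
  then show ?thesis
  proof (rule eventually_mono)
    fix Z
    assume "(\<integral>\<^sup>+x. indicator {Z. born life birth x Z} Z \<partial>count_space UNIV) \<noteq> \<infinity>"
    moreover have "(\<integral>\<^sup>+x. indicator {Z. born life birth x Z} Z \<partial>count_space UNIV)
      = (\<integral>\<^sup>+x. indicator {x. born life birth x Z} x \<partial>count_space UNIV)"
      by (intro nn_integral_cong) (simp add: indicator_def)
    ultimately show "finite {x. born life birth x Z}"
      by (simp add: emeasure_count_space split: if_splits)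
  qed
qed

end

section \<open>The extinction time\<close>

lemma total_time_tree: "total_time L S \<omega> = total_time life birth (\<lambda>x. (L x \<omega>, \<lambda>n. S x n \<omega>))"
  unfolding total_time_def population_def alive_tree[of L S _ \<omega>] by simp

lemma time_at_tree: "time_at L S K \<omega> = time_at life birth K (\<lambda>x. (L x \<omega>, \<lambda>n. S x n \<omega>))"
  unfolding time_at_def population_def alive_tree[of L S _ \<omega>] by simp

lemma population_ge_1_iff: "1 \<le> population L S u \<omega> \<longleftrightarrow> alive L S u \<omega> \<noteq> {}"
  by (auto simp: population_def one_enat_def Suc_le_eq card_gt_0_iff)

lemma time_at_measurable [measurable]: "time_at life birth K \<in> borel_measurable tree_space"
proof -
  have "(\<lambda>Z. \<integral>\<^sup>+u. indicator {0..} u * indicator {(u, Z). population life birth u Z = enat K} (u, Z) \<partial>lborel) \<in> borel_measurable tree_space"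
    by measurable
  then show ?thesis
    unfolding time_at_def[abs_def] by (simp add: indicator_def mult.commute)
qed

context splitting_law begin

lemma nn_integral_total_time:
  "(\<integral>\<^sup>+Z. total_time life birth Z \<partial>tree_law) = (\<integral>\<^sup>+u\<in>{0..}. ennreal (survival u) \<partial>lborel)"
proof -
  interpret P: pair_sigma_finite lborel tree_law ..
  have "(\<integral>\<^sup>+Z. total_time life birth Z \<partial>tree_law)
      = (\<integral>\<^sup>+Z. \<integral>\<^sup>+u. indicator {(u, Z). alive life birth u Z \<noteq> {}} (u, Z) * indicator {0..} u \<partial>lborel \<partial>tree_law)"
    unfolding total_time_def population_ge_1_iff by (intro nn_integral_cong) (simp add: indicator_def)
  also have "\<dots> = (\<integral>\<^sup>+u. \<integral>\<^sup>+Z. indicator {(u, Z). alive life birth u Z \<noteq> {}} (u, Z) * indicator {0..} u \<partial>tree_law \<partial>lborel)"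
    by (rule P.Fubini') measurable
  also have "\<dots> = (\<integral>\<^sup>+u\<in>{0..}. ennreal (survival u) \<partial>lborel)"
  proof (rule nn_integral_cong)
    fix u :: real
    have "(\<integral>\<^sup>+Z. indicator {(u, Z). alive life birth u Z \<noteq> {}} (u, Z) * indicator {0..} u \<partial>tree_law)
        = (\<integral>\<^sup>+Z. indicator {Z. alive life birth u Z \<noteq> {}} Z * indicator {0..} u \<partial>tree_law)"
      by (intro nn_integral_cong) (simp add: indicator_def)
    also have "\<dots> = ennreal (survival u) * indicator {0..} u"
      unfolding emeasure_alive_nonempty[symmetric] nn_integral_indicator[OF alive_nonempty_sets, symmetric]
      by (rule nn_integral_multc) measurable
    finally show "(\<integral>\<^sup>+Z. indicator {(u, Z). alive life birth u Z \<noteq> {}} (u, Z) * indicator {0..} u \<partial>tree_law)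
        = ennreal (survival u) * indicator {0..} u" .
  qed
  finally show ?thesis .
qed

text \<open>With finite progeny \<open>population\<close> is a natural number at every
  \<open>u\<close>, so whenever somebody is alive exactly one summand is 1.\<close>

lemma total_time_eq_suminf:
  assumes fin: "finite {x. born life birth x Z}"
  shows "total_time life birth Z = (\<Sum>K. time_at life birth (Suc K) Z)"
proof -
  have Z: "Z \<in> space tree_space" by (auto simp: space_PiM space_pair_measure)
  have [measurable]: "Measurable.pred borel (\<lambda>u. population life birth u Z = enat K)" for K
    using measurable_compose[OF measurable_Pair2'[OF Z, of borel] population_measurable[of K]] by simp
  have "alive life birth u Z \<subseteq> {x. born life birth x Z}" for u
    by (auto simp: alive_def)
  then have fin: "finite (alive life birth u Z)" for u
    using fin by (rule finite_subset)
  have "total_time life birth Z = (\<integral>\<^sup>+u. (\<Sum>K. indicator {u. population life birth u Z = enat (Suc K)} u * indicator {0..} u) \<partial>lborel)"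
    unfolding total_time_def
  proof (rule nn_integral_cong)
    fix u
    have "(\<Sum>K. indicator {u. population life birth u Z = enat (Suc K)} u :: ennreal) = indicator {u. 1 \<le> population life birth u Z} u"
    proof (cases "card (alive life birth u Z)")
      case 0
      then show ?thesis using fin[of u] by (simp add: population_def one_enat_def)
    next
      case (Suc m)
      have "(\<Sum>K. indicator {u. population life birth u Z = enat (Suc K)} u :: ennreal)
          = (\<Sum>K\<in>{m}. indicator {u. population life birth u Z = enat (Suc K)} u)"
        by (rule suminf_finite) (auto simp: population_def fin Suc)
      then show ?thesis using Suc fin[of u] by (simp add: population_def one_enat_def)
    qed
    then show "indicator {u. 1 \<le> population life birth u Z} u * indicator {0..} u
      = (\<Sum>K. indicator {u. population life birth u Z = enat (Suc K)} u * indicator {0..} u :: ennreal)"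
      by simp
  qed
  also have "\<dots> = (\<Sum>K. time_at life birth (Suc K) Z)"
    unfolding time_at_def by (rule nn_integral_suminf) measurable
  finally show ?thesis .
qed

end

section \<open>Transfer from a given sample space to the law of the tree\<close>

lemma indep_vars_pair_distr:
  assumes "prob_space M" and ind: "prob_space.indep_vars M (\<lambda>_. N) X UNIV" and ij: "i \<noteq> j"
    and f: "f \<in> N \<rightarrow>\<^sub>M A" and g: "g \<in> N \<rightarrow>\<^sub>M B"
  shows "distr M (A \<Otimes>\<^sub>M B) (\<lambda>\<omega>. (f (X i \<omega>), g (X j \<omega>))) = distr M A (\<lambda>\<omega>. f (X i \<omega>)) \<Otimes>\<^sub>M distr M B (\<lambda>\<omega>. g (X j \<omega>))"
proof -
  interpret prob_space M by fact
  have rv: "X k \<in> M \<rightarrow>\<^sub>M N" for k using ind by (simp add: indep_vars_def)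
  have iv: "indep_var (PiM {i} (\<lambda>_. N)) (\<lambda>\<omega>. restrict (\<lambda>k. X k \<omega>) {i}) (PiM {j} (\<lambda>_. N)) (\<lambda>\<omega>. restrict (\<lambda>k. X k \<omega>) {j})"
    by (rule indep_var_restrict[OF ind]) (use ij in auto)
  have "(\<lambda>R. R k) \<in> PiM {k} (\<lambda>_. N) \<rightarrow>\<^sub>M N" for k
    by (rule measurable_component_singleton) simp
  then have "indep_var N ((\<lambda>R. R i) \<circ> (\<lambda>\<omega>. restrict (\<lambda>k. X k \<omega>) {i})) N ((\<lambda>R. R j) \<circ> (\<lambda>\<omega>. restrict (\<lambda>k. X k \<omega>) {j}))"
    by (intro indep_var_compose[OF iv])
  then have "indep_var N (X i) N (X j)" by (simp add: comp_def)
  then have XX: "distr M N (X i) \<Otimes>\<^sub>M distr M N (X j) = distr M (N \<Otimes>\<^sub>M N) (\<lambda>\<omega>. (X i \<omega>, X j \<omega>))"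
    by (simp add: indep_var_distribution_eq)
  interpret B: prob_space "distr (distr M N (X j)) B g"
    by (intro prob_space.prob_space_distr prob_space_distr rv) (use g in simp)
  have "distr M A (\<lambda>\<omega>. f (X i \<omega>)) \<Otimes>\<^sub>M distr M B (\<lambda>\<omega>. g (X j \<omega>))
      = distr (distr M N (X i)) A f \<Otimes>\<^sub>M distr (distr M N (X j)) B g"
    using f g rv by (simp add: distr_distr comp_def)
  also have "\<dots> = distr (distr M N (X i) \<Otimes>\<^sub>M distr M N (X j)) (A \<Otimes>\<^sub>M B) (\<lambda>(x, y). (f x, g y))"
    by (rule pair_measure_distr) (use f g in \<open>auto intro: B.sigma_finite_measure_axioms\<close>)
  also have "\<dots> = distr M (A \<Otimes>\<^sub>M B) ((\<lambda>(x, y). (f x, g y)) \<circ> (\<lambda>\<omega>. (X i \<omega>, X j \<omega>)))"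
    unfolding XX
  proof (rule distr_distr)
    note f [measurable] and g [measurable] and rv [measurable]
    show "(\<lambda>(x, y). (f x, g y)) \<in> N \<Otimes>\<^sub>M N \<rightarrow>\<^sub>M A \<Otimes>\<^sub>M B" by measurable
    show "(\<lambda>\<omega>. (X i \<omega>, X j \<omega>)) \<in> M \<rightarrow>\<^sub>M N \<Otimes>\<^sub>M N" by measurable
  qed
  finally show ?thesis by (simp add: comp_def)
qed

lemma (in prob_space) poisson_points_distr:
  assumes S: "poisson_points M r S"
  shows "S n \<in> borel_measurable M"
    and "distr M (\<Pi>\<^sub>M n\<in>UNIV. borel) (\<lambda>\<omega> n. S n \<omega>) = birth_law r"
proof -
  define W where "W n \<omega> = (if n = 0 then S 0 \<omega> else S n \<omega> - S (n - 1) \<omega>)" for n \<omega>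
  have ind: "indep_vars (\<lambda>_. borel) W UNIV" and dist: "distributed M lborel (W n) (exponential_density r)" for n
    using S unfolding poisson_points_def W_def[abs_def] Let_def by auto
  have rv [measurable]: "W n \<in> borel_measurable M" for n
    using ind by (simp add: indep_vars_def)
  have SW: "S n \<omega> = (\<Sum>i\<le>n. W i \<omega>)" for n \<omega>
    by (induction n) (auto simp: W_def)
  show Sm: "S n \<in> borel_measurable M" for n
    unfolding SW[abs_def] by measurable
  have "distr M (\<Pi>\<^sub>M n\<in>UNIV. borel) (\<lambda>\<omega> n. W n \<omega>) = (\<Pi>\<^sub>M n\<in>UNIV. distr M borel (W n))"
    using ind by (subst (asm) indep_vars_iff_distr_eq_PiM) (auto simp: restrict_def)
  also have "\<dots> = waiting_times r"
    using dist by (intro PiM_cong) (auto simp: distributed_def cong: distr_cong)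
  finally have WW: "distr M (\<Pi>\<^sub>M n\<in>UNIV. borel) (\<lambda>\<omega> n. W n \<omega>) = waiting_times r" .
  have Wm: "(\<lambda>\<omega> n. W n \<omega>) \<in> M \<rightarrow>\<^sub>M (\<Pi>\<^sub>M n\<in>UNIV. borel)"
    by (intro measurable_PiM_single') (auto simp: space_PiM)
  have pm: "(\<lambda>w n. sum w {..n}) \<in> (\<Pi>\<^sub>M n\<in>UNIV. borel) \<rightarrow>\<^sub>M (\<Pi>\<^sub>M n\<in>(UNIV :: nat set). (borel :: real measure))"
    by (intro measurable_PiM_single') (auto simp: space_PiM)
  have "birth_law r = distr M (\<Pi>\<^sub>M n\<in>UNIV. borel) ((\<lambda>w n. sum w {..n}) \<circ> (\<lambda>\<omega> n. W n \<omega>))"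
    unfolding birth_law_def WW[symmetric] by (rule distr_distr[OF pm Wm])
  also have "(\<lambda>w n. sum w {..n}) \<circ> (\<lambda>\<omega> n. W n \<omega>) = (\<lambda>\<omega> n. S n \<omega>)"
    by (simp add: fun_eq_iff SW)
  finally show "distr M (\<Pi>\<^sub>M n\<in>UNIV. borel) (\<lambda>\<omega> n. S n \<omega>) = birth_law r" by simp
qed

lemma (in binary_splitting_tree) tree_measurable:
  "(\<lambda>\<omega> x. (L x \<omega>, \<lambda>n. S x n \<omega>)) \<in> M \<rightarrow>\<^sub>M tree_space"
proof (rule measurable_PiM_single')
  note life_measurable [measurable]
  have S: "(\<lambda>\<omega> n. S x n \<omega>) \<in> M \<rightarrow>\<^sub>M (\<Pi>\<^sub>M n\<in>UNIV. borel)" for x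
    by (intro measurable_PiM_single' poisson_points_distr(1)[OF births_poisson]) (auto simp: space_PiM)
  show "(\<lambda>\<omega>. (L x \<omega>, \<lambda>n. S x n \<omega>)) \<in> M \<rightarrow>\<^sub>M node_space" for x
    using S by measurable
qed (auto simp: space_PiM space_pair_measure)

lemma (in binary_splitting_tree) tree_distr:
  "distr M tree_space (\<lambda>\<omega> x. (L x \<omega>, \<lambda>n. S x n \<omega>)) = (\<Pi>\<^sub>M x\<in>UNIV. life_law \<Otimes>\<^sub>M birth_law \<delta>)"
proof -
  let ?R = "\<Pi>\<^sub>M n\<in>(UNIV :: nat set). (borel :: real measure)"
  \<comment> \<open>A family of random variables has one value type, so a life-length is stored as a
    constant sequence. Its events are events of \<open>L x\<close>, so \<open>indep\<close> carries
    over to \<open>Y\<close>.\<close>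
  define Y :: "nat list + nat list \<Rightarrow> 'w \<Rightarrow> nat \<Rightarrow> real" where
    "Y = case_sum (\<lambda>x \<omega> n. L x \<omega>) (\<lambda>x \<omega> n. S x n \<omega>)"
  have const: "(\<lambda>(l :: real) n :: nat. l) \<in> borel \<rightarrow>\<^sub>M ?R"
    by (intro measurable_PiM_single') (auto simp: space_PiM)
  have S: "(\<lambda>\<omega> n. S x n \<omega>) \<in> M \<rightarrow>\<^sub>M ?R" for x
    by (intro measurable_PiM_single' poisson_points_distr(1)[OF births_poisson]) (auto simp: space_PiM)
  have Y: "Y k \<in> M \<rightarrow>\<^sub>M ?R" for k
    using S measurable_compose[OF life_measurable const] by (auto simp: Y_def split: sum.split)
  have ind: "indep_vars (\<lambda>_. ?R) Y UNIV"
    unfolding indep_vars_def2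
  proof (intro conjI ballI Y indep_sets_mono_sets[OF indep])
    fix k :: "nat list + nat list"
    show "{Y k -` A \<inter> space M |A. A \<in> sets ?R} \<subseteq>
      (case k of Inl x \<Rightarrow> sets (vimage_algebra (space M) (L x) borel)
        | Inr x \<Rightarrow> sets (vimage_algebra (space M) (\<lambda>\<omega> n. S x n \<omega>) ?R))"
    proof (cases k)
      case (Inl x)
      have "Y k -` A \<inter> space M = L x -` ((\<lambda>l n. l) -` A \<inter> space borel) \<inter> space M" for A
        by (auto simp: Inl Y_def)
      then show ?thesis
        using measurable_sets[OF const] by (auto simp: Inl intro!: in_vimage_algebra)
    next
      case (Inr x)
      then show ?thesis by (auto simp: Y_def intro!: in_vimage_algebra)
    qed
  qed
  \<comment> \<open>Grouping the two indices of each individual makes the nodes independent, entry 0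
    of the constant sequence recovering the life-length. Independence inside a node is used
    separately, through \<open>indep_vars_pair_distr\<close>.\<close>
  define K :: "nat list \<Rightarrow> (nat list + nat list) set" where "K x = {Inl x, Inr x}" for x
  have "indep_vars (\<lambda>x. PiM (K x) (\<lambda>_. ?R)) (\<lambda>x \<omega>. restrict (\<lambda>k. Y k \<omega>) (K x)) UNIV"
    by (rule indep_vars_restrict[OF ind]) (auto simp: disjoint_family_on_def K_def)
  then have "indep_vars (\<lambda>x. node_space) (\<lambda>x \<omega>. (\<lambda>R. (R (Inl x) 0, R (Inr x))) (restrict (\<lambda>k. Y k \<omega>) (K x))) UNIV"
  proof (rule indep_vars_compose2)
    fix x
    have "(\<lambda>R. R (Inl x) 0) \<in> PiM (K x) (\<lambda>_. ?R) \<rightarrow>\<^sub>M borel"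
      by (rule measurable_compose[OF measurable_component_singleton[of "Inl x"] measurable_component_singleton[of 0]])
        (auto simp: K_def)
    moreover have "(\<lambda>R. R (Inr x)) \<in> PiM (K x) (\<lambda>_. ?R) \<rightarrow>\<^sub>M ?R"
      by (rule measurable_component_singleton) (auto simp: K_def)
    ultimately show "(\<lambda>R. (R (Inl x) 0, R (Inr x))) \<in> PiM (K x) (\<lambda>_. ?R) \<rightarrow>\<^sub>M node_space"
      by (rule measurable_Pair)
  qed
  then have "indep_vars (\<lambda>x. node_space) (\<lambda>x \<omega>. (L x \<omega>, \<lambda>n. S x n \<omega>)) UNIV"
    by (simp add: K_def Y_def)
  then have "distr M tree_space (\<lambda>\<omega> x. (L x \<omega>, \<lambda>n. S x n \<omega>)) = (\<Pi>\<^sub>M x\<in>UNIV. distr M node_space (\<lambda>\<omega>. (L x \<omega>, \<lambda>n. S x n \<omega>)))"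
    by (subst (asm) indep_vars_iff_distr_eq_PiM)
      (auto simp: restrict_def intro!: measurable_Pair life_measurable S)
  also have "\<dots> = (\<Pi>\<^sub>M x\<in>UNIV. life_law \<Otimes>\<^sub>M birth_law \<delta>)"
  proof (rule PiM_cong)
    fix x
    have "(\<lambda>r. r 0) \<in> ?R \<rightarrow>\<^sub>M borel" by (rule measurable_component_singleton) simp
    from indep_vars_pair_distr[OF prob_space_axioms ind _ this measurable_ident, of "Inl x" "Inr x"]
    show "distr M node_space (\<lambda>\<omega>. (L x \<omega>, \<lambda>n. S x n \<omega>)) = life_law \<Otimes>\<^sub>M birth_law \<delta>"
      by (simp add: Y_def life_distr poisson_points_distr(2)[OF births_poisson])
  qed simp
  finally show ?thesis .
qed

theorem corollary1p1:
  fixes \<delta> :: real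
    and N :: "'q measure" and Q :: "'q \<Rightarrow> real"
    and M :: "'w measure"
    and L :: "nat list \<Rightarrow> 'w \<Rightarrow> real"
    and S :: "nat list \<Rightarrow> nat \<Rightarrow> 'w \<Rightarrow> real"
  assumes delta: "0 < \<delta>" "\<delta> < 1"
    and N: "prob_space N"
    and Q: "Q \<in> borel_measurable N" "AE x in N. Q x > 0"
    and Q_mean: "integrable N Q" "prob_space.expectation N Q = 1"
    and tree: "binary_splitting_tree M \<delta> (distr N borel Q) L S"
  shows "(AE \<omega> in M. total_time L S \<omega> = (\<Sum>K. time_at L S (Suc K) \<omega>)) \<and>
         (\<integral>\<^sup>+\<omega>. total_time L S \<omega> \<partial>M) = (\<Sum>K. \<integral>\<^sup>+\<omega>. time_at L S (Suc K) \<omega> \<partial>M) \<and>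
         (\<Sum>K. \<integral>\<^sup>+\<omega>. time_at L S (Suc K) \<omega> \<partial>M) = ennreal (- ln (1 - \<delta>) / \<delta>)"
proof -
  interpret N: prob_space N by (rule N)
  interpret T: binary_splitting_tree M \<delta> "distr N borel Q" L S by (rule tree)
  interpret P: splitting_law \<delta> "distr N borel Q"
    by (rule splitting_law.intro) (use delta Q N.prob_space_distr in simp_all)
  define F where "F \<omega> x = (L x \<omega>, \<lambda>n. S x n \<omega>)" for \<omega> x
  have F: "F \<in> M \<rightarrow>\<^sub>M tree_space"
    using T.tree_measurable by (simp add: F_def[abs_def])
  have distr_F: "distr M tree_space F = P.tree_law"
    using T.tree_distr by (simp add: F_def[abs_def])
  have mean: "(\<integral>\<^sup>+l. ennreal l \<partial>distr N borel Q) = 1"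
  proof -
    have "(\<integral>\<^sup>+l. ennreal l \<partial>distr N borel Q) = (\<integral>\<^sup>+x. ennreal (Q x) \<partial>N)"
      using Q(1) by (intro nn_integral_distr) auto
    also have "\<dots> = ennreal (N.expectation Q)"
      using Q_mean(1) Q(2) by (intro nn_integral_eq_integral) (auto elim: eventually_mono)
    finally show ?thesis using Q_mean(2) by simp
  qed
  have pos: "AE l in distr N borel Q. 0 < l"
    using Q by (subst AE_distr_iff) auto
  have sum_tree: "AE Z in P.tree_law. total_time life birth Z = (\<Sum>K. time_at life birth (Suc K) Z)"
    using P.AE_finite_progeny[OF mean delta(2)] by eventually_elim (rule P.total_time_eq_suminf)
  have "AE \<omega> in M. total_time life birth (F \<omega>) = (\<Sum>K. time_at life birth (Suc K) (F \<omega>))"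
    using sum_tree unfolding distr_F[symmetric] by (rule AE_distrD[OF F])
  moreover have F_total: "total_time L S \<omega> = total_time life birth (F \<omega>)" for \<omega>
    unfolding F_def[abs_def] by (rule total_time_tree)
  moreover have F_time_at: "time_at L S K \<omega> = time_at life birth K (F \<omega>)" for K \<omega>
    unfolding F_def[abs_def] by (rule time_at_tree)
  ultimately have sum: "AE \<omega> in M. total_time L S \<omega> = (\<Sum>K. time_at L S (Suc K) \<omega>)"
    by simp
  have time_at: "(\<integral>\<^sup>+\<omega>. time_at L S K \<omega> \<partial>M) = (\<integral>\<^sup>+Z. time_at life birth K Z \<partial>P.tree_law)" for K
    unfolding distr_F[symmetric] F_time_at by (rule nn_integral_distr[OF F, symmetric]) measurable
  have [measurable]: "(\<lambda>\<omega>. time_at L S K \<omega>) \<in> borel_measurable M" for K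
    unfolding F_time_at by (rule measurable_compose[OF F time_at_measurable])
  \<comment> \<open>The integrals of \<open>time_at\<close> are transported along \<open>F\<close>;
    that of \<open>total_time\<close> is reached through the almost sure identity on each side,
    \<open>sum\<close> here and \<open>sum_tree\<close> below.\<close>
  have total: "(\<integral>\<^sup>+\<omega>. total_time L S \<omega> \<partial>M) = (\<Sum>K. \<integral>\<^sup>+\<omega>. time_at L S (Suc K) \<omega> \<partial>M)"
    by (subst nn_integral_cong_AE[OF sum], rule nn_integral_suminf) measurable
  have "(\<Sum>K. \<integral>\<^sup>+\<omega>. time_at L S (Suc K) \<omega> \<partial>M) = (\<integral>\<^sup>+Z. (\<Sum>K. time_at life birth (Suc K) Z) \<partial>P.tree_law)"
    unfolding time_at by (rule nn_integral_suminf[symmetric]) measurable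
  also have "\<dots> = (\<integral>\<^sup>+Z. total_time life birth Z \<partial>P.tree_law)"
    using sum_tree by (intro nn_integral_cong_AE) (auto elim: eventually_mono)
  also have "\<dots> = (\<integral>\<^sup>+u\<in>{0..}. ennreal (P.survival u) \<partial>lborel)"
    by (rule P.nn_integral_total_time)
  also have "\<dots> = ennreal (- ln (1 - \<delta>) / \<delta>)"
    by (rule P.nn_integral_hazard[OF P.prob_law _ pos mean P.renewal[OF _ pos] delta(2)]) auto
  finally show ?thesis using sum total by simp
qed

end
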